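(* Let $c>0$, $k\in(0,1)$, $d\in\mathbb R$, let $\gamma:\mathbb R\to\mathbb R$ be $1$-periodic and $C^2$, and consider the system $$\ddot\psi=4\left(c^2\sin\psi+\varepsilon\gamma(t)z\right),\qquad \dot z=\varepsilon\gamma(t)\dot\psi.\qquad( * )$$ Suppose that $K(k)\,k=\frac{cp}{q}$ for some $p,q\in\mathbb N$ (positive integers), that $d<\frac{8c^2}{k^2}(1-k^2)$, and that, with $T:=p$, there is an $\alpha_0\in\mathbb R$ such that $$\int_0^T\gamma(t+\alpha_0)\,\mathrm{dn}\Big(\frac{2ct}{k},k\Big)dt=0\quad\text{and}\quad\int_0^T\dot\gamma(t+\alpha_0)\,\mathrm{dn}\Big(\frac{2ct}{k},k\Big)dt\ne0 .$$ Then there is a $\delta>0$ such that for any $0\neq\varepsilon\in(-\delta,\delta)$ there are precisely two $p$-shift-periodic solutions $(\psi^l_\pm,z^l_\pm)$ of $( * )$ on the level set $\frac{\dot\psi^2}{2}-4c^2(1-\cos\psi)-2z^2=d$ with $$(\psi^l_\pm(t),z^l_\pm(t))=\Big(\psi^l_{k,c}(t-\alpha_0),\ \pm\sqrt{\tfrac{4c^2}{k^2}(1-k^2)-\tfrac d2}\Big)+O(\varepsilon),$$ one for each sign. Explicitly: for every sufficiently large $C>0$ there is $\delta>0$ such that for $0<|\varepsilon|<\delta$ and each choice of sign there is exactly one $p$-shift-periodic solution on this level set whose distance, uniformly in $t$, from the displayed leading term is at most $C|\varepsilon|$.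
   Context: $K(k)$ is the complete elliptic integral of the first kind with modulus $k$; $\mathrm{am}(\cdot,k)$ is the Jacobi amplitude and $\mathrm{dn}(\cdot,k)$ the Jacobi elliptic function of modulus $k$. The function $$\psi^l_{k,c}(t)=\pi+2\,\mathrm{am}\Big(\frac{2ct}{k},k\Big)$$ is a solution of $\ddot\psi=4c^2\sin\psi$ with $\psi^l_{k,c}(t+T^l)=\psi^l_{k,c}(t)+2\pi$, $T^l=\frac{K(k)k}{c}$ (the superscript $l$ is only a label). Here a solution $(\psi,z)$ is called $p$-shift-periodic if $\psi(t+p)=\psi(t)+2\pi q$ and $z(t+p)=z(t)$ for all $t$ (recall $p=qT^l$). Along every solution of $( * )$ the quantity $\frac{\dot\psi^2}{2}-4c^2(1-\cos\psi)-2z^2$ is constant; the number $d$ is the fixed value of this first integral. *)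

theory Defs
  imports "HOL-Analysis.Analysis"
begin

text \<open>
  In all elliptic functions below the second argument \<open>k\<close> is the modulus (not the parameter
  \<open>k\<^sup>2\<close>), and \<open>0 < k < 1\<close> is intended. The interval integral is oriented, so the
  incomplete integral is an odd function of its upper limit \<open>\<phi>\<close>.
\<close>

definition incomplete_ellF :: "real \<Rightarrow> real \<Rightarrow> real" where
  "incomplete_ellF \<phi> k = (LBINT \<theta>=0..ereal \<phi>. 1 / sqrt (1 - k\<^sup>2 * (sin \<theta>)\<^sup>2))"

definition complete_ellK :: "real \<Rightarrow> real" where
  "complete_ellK k = incomplete_ellF (pi / 2) k"

text \<open>For \<open>0 < k < 1\<close> the map \<open>\<phi> \<mapsto> incomplete_ellF \<phi> k\<close> is an increasing bijection of the real line
  onto itself, and the amplitude is its inverse.\<close>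

definition jacobi_am :: "real \<Rightarrow> real \<Rightarrow> real" where
  "jacobi_am u k = (THE \<phi>. incomplete_ellF \<phi> k = u)"

definition jacobi_dn :: "real \<Rightarrow> real \<Rightarrow> real" where
  "jacobi_dn u k = sqrt (1 - k\<^sup>2 * (sin (jacobi_am u k))\<^sup>2)"

definition psi_l :: "real \<Rightarrow> real \<Rightarrow> real \<Rightarrow> real" where
  "psi_l k c t = pi + 2 * jacobi_am (2 * c * t / k) k"

definition C2_real :: "(real \<Rightarrow> real) \<Rightarrow> bool" where
  "C2_real f \<longleftrightarrow>
     (\<forall>t. f differentiable (at t)) \<and>
     (\<forall>t. deriv f differentiable (at t)) \<and>
     continuous_on UNIV (deriv (deriv f))"

definition is_solution ::
    "real \<Rightarrow> (real \<Rightarrow> real) \<Rightarrow> real \<Rightarrow> (real \<Rightarrow> real) \<Rightarrow> (real \<Rightarrow> real) \<Rightarrow> bool" where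
  "is_solution c \<gamma> \<epsilon> \<psi> z \<longleftrightarrow>
     (\<forall>t. \<psi> differentiable (at t)) \<and>
     (\<forall>t. (deriv \<psi> has_real_derivative 4 * (c\<^sup>2 * sin (\<psi> t) + \<epsilon> * \<gamma> t * z t)) (at t)) \<and>
     (\<forall>t. (z has_real_derivative \<epsilon> * \<gamma> t * deriv \<psi> t) (at t))"

definition shift_periodic :: "nat \<Rightarrow> nat \<Rightarrow> (real \<Rightarrow> real) \<Rightarrow> (real \<Rightarrow> real) \<Rightarrow> bool" where
  "shift_periodic p q \<psi> z \<longleftrightarrow>
     (\<forall>t. \<psi> (t + real p) = \<psi> t + 2 * pi * real q \<and> z (t + real p) = z t)"

definition on_level_set :: "real \<Rightarrow> real \<Rightarrow> (real \<Rightarrow> real) \<Rightarrow> (real \<Rightarrow> real) \<Rightarrow> bool" where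
  "on_level_set c d \<psi> z \<longleftrightarrow>
     (\<forall>t. (deriv \<psi> t)\<^sup>2 / 2 - 4 * c\<^sup>2 * (1 - cos (\<psi> t)) - 2 * (z t)\<^sup>2 = d)"

text \<open>The sign \<open>s\<close> is \<open>1\<close> or \<open>-1\<close> and selects the branch of the square root.\<close>

definition leading_term ::
    "real \<Rightarrow> real \<Rightarrow> real \<Rightarrow> real \<Rightarrow> real \<Rightarrow> real \<Rightarrow> real \<times> real" where
  "leading_term k c d \<alpha> s t =
     (psi_l k c (t - \<alpha>), s * sqrt (4 * c\<^sup>2 / k\<^sup>2 * (1 - k\<^sup>2) - d / 2))"

definition uniformly_within ::
    "real \<Rightarrow> (real \<Rightarrow> real \<times> real) \<Rightarrow> (real \<Rightarrow> real) \<Rightarrow> (real \<Rightarrow> real) \<Rightarrow> bool" where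
  "uniformly_within r L \<psi> z \<longleftrightarrow> (\<forall>t. dist (\<psi> t, z t) (L t) \<le> r)"

end

(* On the level set, with phi = (psi - pi) / 2 and phi' > 0, the system is of first order in (phi, z).
   Taking the angle phi as independent variable makes it triangular up to the small factor epsilon:
     dt/dphi = G(phi, z),   dz/dphi = 2 epsilon gamma(t),   G = 1 / sqrt(d/2 + z^2 + 4 c^2 cos^2 phi).
   With x and y the deviations of t and z from the unperturbed orbit, shift-periodic solutions become
   (pi q)-periodic solutions of x' = P(phi, y), y' = epsilon Q(phi, x).  The right-hand sides must
   have zero mean; both conditions can be solved by a Newton step, the first for the mean of y,
   because dG/dz < 0, and the second for the mean of x, because the derivative of the Melnikov
   integral does not vanish.  Integrating after these corrections is a map on pairs of periodic
   functions that contracts by a factor O(epsilon), so Banach's theorem gives existence and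
   uniqueness.  Replacing (epsilon, z) by (-epsilon, -z) exchanges the two signs. *)
theory Submission
  imports Defs
begin

section \<open>Means and antiderivatives of periodic functions\<close>

text \<open>At \<epsilon> = 0 the periodic solutions near the given orbit are its time translates (y
  = 0, x any constant), so they are not isolated and the linearized problem is not invertible there.
  For \<epsilon> \<noteq> 0 the mean of \<epsilon> Q vanishes exactly if that of Q does; the
  condition is imposed on Q itself, and the Newton divisors then do not depend on \<epsilon>. All
  deviations are sought at size R |\<epsilon>|: on such a ball the Newton remainders have Lipschitz
  constants of order \<epsilon>, since both nonlinearities have bounded second derivatives in the
  deviation. This is where C^2 of \<gamma> enters. The bound on d says that the level set gives a
  leading value z0 > 0, which makes dG/dz negative; k < 1 keeps the speed of the unperturbed orbit
  away from 0, so that G stays smooth in a neighbourhood of fixed size.\<close>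

definition prim :: "(real \<Rightarrow> real) \<Rightarrow> real \<Rightarrow> real" where
  "prim f x = (LBINT y=0..ereal x. f y)"

lemma prim_has_derivative:
  assumes "continuous_on UNIV f"
  shows "(prim f has_real_derivative f x) (at x)"
proof -
  let ?b = "\<bar>x\<bar> + 1"
  have "((\<lambda>u. LBINT y=ereal 0..ereal u. f y) has_vector_derivative f x) (at x within {-?b..?b})"
    using assms by (intro interval_integral_FTC2) (auto intro: continuous_on_subset)
  moreover have "at x within {-?b..?b} = at x"
    by (rule at_within_Icc_at) auto
  ultimately show ?thesis
    by (simp add: prim_def[abs_def] has_real_derivative_iff_has_vector_derivative zero_ereal_def)
qed

lemma prim_0 [simp]: "prim f 0 = 0"
  by (simp add: prim_def zero_ereal_def)

lemma prim_unique:
  assumes "continuous_on UNIV f" "\<And>x. (F has_real_derivative f x) (at x)"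
  shows "prim f x = F x - F 0"
proof -
  have "((\<lambda>x. prim f x - F x) has_real_derivative 0) (at x)" for x
    using DERIV_diff[OF prim_has_derivative[OF assms(1)] assms(2)] by simp
  then have "prim f x - F x = prim f 0 - F 0"
    using DERIV_isconst_all by blast
  then show ?thesis by simp
qed

lemma prim_bound:
  assumes "continuous_on UNIV f" "\<And>t. \<bar>f t\<bar> \<le> B" "0 \<le> x"
  shows "\<bar>prim f x\<bar> \<le> B * x"
proof (cases "x = 0")
  case False
  with assms(3) have "0 < x" by simp
  then obtain z where "prim f x - prim f 0 = (x - 0) * f z"
    using MVT2[of 0 x "prim f" f] prim_has_derivative[OF assms(1)] by blast
  then show ?thesis
    using assms(2)[of z] \<open>0 < x\<close> by (simp add: abs_mult mult.commute)
qed simp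

lemma prim_diff:
  assumes "continuous_on UNIV f" "continuous_on UNIV g"
  shows "prim (\<lambda>t. f t - g t) x = prim f x - prim g x"
  by (subst prim_unique[where F = "\<lambda>x. prim f x - prim g x"])
    (auto intro!: continuous_intros assms derivative_eq_intros prim_has_derivative)

lemma prim_cmult:
  assumes "continuous_on UNIV f"
  shows "prim (\<lambda>t. a * f t) x = a * prim f x"
  by (subst prim_unique[where F = "\<lambda>x. a * prim f x"])
    (auto intro!: continuous_intros assms derivative_eq_intros prim_has_derivative)

lemma integral_eq_prim:
  assumes "continuous_on UNIV f" "0 \<le> x"
  shows "integral {0..x} f = prim f x"
proof -
  have "(f has_integral prim f x - prim f 0) {0..x}"
    using assms by (intro fundamental_theorem_of_calculus)
      (auto simp: has_real_derivative_iff_has_vector_derivative[symmetric]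
        intro: has_field_derivative_at_within prim_has_derivative)
  then show ?thesis by (simp add: integral_unique)
qed

definition periodic :: "real \<Rightarrow> (real \<Rightarrow> 'a) \<Rightarrow> bool" where
  "periodic L f \<longleftrightarrow> (\<forall>t. f (t + L) = f t)"

lemma periodic_int:
  assumes "periodic L f"
  shows "f (t + of_int n * L) = f t"
proof -
  have *: "f (t + of_nat n * L) = f t" for n t
  proof (induction n)
    case (Suc n)
    have "t + of_nat (Suc n) * L = (t + of_nat n * L) + L" by (simp add: algebra_simps)
    then show ?case using Suc assms by (simp only: periodic_def)
  qed simp
  show ?thesis
  proof (cases "n \<ge> 0")
    case True
    then show ?thesis using *[of t "nat n"] by simp
  next
    case False
    then show ?thesis using *[of "t + of_int n * L" "nat (- n)"] by simp
  qed
qed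

lemma periodic_representative:
  assumes "periodic L f" "0 < L"
  obtains s where "0 \<le> s" "s \<le> L" "f s = f t"
proof
  let ?n = "\<lfloor>t / L\<rfloor>"
  have "of_int ?n \<le> t / L" "t / L < of_int ?n + 1" by linarith+
  then have "of_int ?n * L \<le> t" "t < (of_int ?n + 1) * L"
    using assms(2) by (simp_all only: pos_le_divide_eq pos_divide_less_eq)
  then show "0 \<le> t + of_int (- ?n) * L" "t + of_int (- ?n) * L \<le> L"
    by (simp_all add: algebra_simps)
  show "f (t + of_int (- ?n) * L) = f t"
    by (rule periodic_int[OF assms(1)])
qed

lemma periodic_bounded:
  fixes f :: "real \<Rightarrow> real"
  assumes "periodic L f" "0 < L" "continuous_on UNIV f"
  obtains B where "0 < B" "\<And>t. \<bar>f t\<bar> \<le> B"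
proof -
  have "bounded (f ` {0..L})"
    using assms by (intro compact_imp_bounded compact_continuous_image)
      (auto intro: continuous_on_subset)
  then obtain B where "0 < B" "\<And>s. s \<in> {0..L} \<Longrightarrow> \<bar>f s\<bar> \<le> B"
    unfolding bounded_pos by auto
  then show ?thesis
    using periodic_representative[OF assms(1,2)] that by (metis atLeastAtMost_iff)
qed

definition mean :: "real \<Rightarrow> (real \<Rightarrow> real) \<Rightarrow> real" where
  "mean L f = prim f L / L"

text \<open>Removing the drift \<open>mean L f * x\<close> is what keeps the antiderivative of a
  periodic function periodic (\<open>periodic_osc\<close>). The value 0 at 0 is a normalization: a
  periodic solution of x' = f equals \<open>x 0\<close> plus \<open>osc L f\<close>.\<close>

definition osc :: "real \<Rightarrow> (real \<Rightarrow> real) \<Rightarrow> real \<Rightarrow> real" where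
  "osc L f x = prim f x - mean L f * x"

lemma mean_bound:
  assumes "0 < L" "continuous_on UNIV f" "\<And>t. \<bar>f t\<bar> \<le> B"
  shows "\<bar>mean L f\<bar> \<le> B"
  using prim_bound[OF assms(2,3), of L] assms(1)
  by (simp add: mean_def field_simps)

lemma mean_diff:
  assumes "continuous_on UNIV f" "continuous_on UNIV g"
  shows "mean L (\<lambda>t. f t - g t) = mean L f - mean L g"
  using prim_diff[OF assms] by (simp add: mean_def diff_divide_distrib)

lemma mean_cmult:
  assumes "continuous_on UNIV f"
  shows "mean L (\<lambda>t. a * f t) = a * mean L f"
  using prim_cmult[OF assms] by (simp add: mean_def)

lemma mean_derivative:
  assumes "continuous_on UNIV f" "\<And>x. (F has_real_derivative f x) (at x)" "periodic L F"
  shows "mean L f = 0"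
  using assms(3)[unfolded periodic_def, rule_format, of 0]
  by (simp add: mean_def prim_unique[OF assms(1,2)])

lemma osc_0 [simp]: "osc L f 0 = 0"
  by (simp add: osc_def)

lemma osc_has_derivative:
  assumes "continuous_on UNIV f"
  shows "(osc L f has_real_derivative f x - mean L f) (at x)"
  unfolding osc_def[abs_def]
  by (auto intro!: derivative_eq_intros prim_has_derivative assms)

lemma continuous_osc:
  assumes "continuous_on UNIV f"
  shows "continuous_on S (osc L f)"
  using osc_has_derivative[OF assms] DERIV_isCont continuous_at_imp_continuous_on by blast

lemma osc_diff:
  assumes "continuous_on UNIV f" "continuous_on UNIV g"
  shows "osc L (\<lambda>t. f t - g t) x = osc L f x - osc L g x"
  using prim_diff[OF assms] mean_diff[OF assms] by (simp add: osc_def left_diff_distrib)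

lemma periodic_osc:
  assumes "0 < L" "continuous_on UNIV f" "periodic L f"
  shows "periodic L (osc L f)"
proof -
  have "((\<lambda>x. prim f (x + L) - prim f x) has_real_derivative f (x + L) - f x) (at x)" for x
    using DERIV_shift[of "prim f" "f (x + L)" x L] prim_has_derivative[OF assms(2)]
    by (intro DERIV_diff) auto
  then have "((\<lambda>x. prim f (x + L) - prim f x) has_real_derivative 0) (at x)" for x
    using assms(3) by (simp add: periodic_def)
  then have "prim f (x + L) - prim f x = prim f (0 + L) - prim f 0" for x
    using DERIV_isconst_all by blast
  then show ?thesis
    using assms(1) by (simp add: periodic_def osc_def mean_def field_simps)
qed

text \<open>By periodicity it suffices to look at [0, L], where the antiderivative and the drift are
  each at most \<open>L * B\<close>.\<close>

lemma osc_bound: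
  assumes "0 < L" "continuous_on UNIV f" "periodic L f" "\<And>t. \<bar>f t\<bar> \<le> B"
  shows "\<bar>osc L f x\<bar> \<le> 2 * L * B"
proof -
  obtain s where s: "0 \<le> s" "s \<le> L" "osc L f s = osc L f x"
    using periodic_representative[OF periodic_osc[OF assms(1-3)] assms(1)] .
  have "0 \<le> B" using assms(4)[of 0] by linarith
  have "\<bar>osc L f s\<bar> \<le> \<bar>prim f s\<bar> + \<bar>mean L f\<bar> * s"
    using s(1) abs_triangle_ineq4[of "prim f s" "mean L f * s"] by (simp add: osc_def abs_mult)
  also have "\<dots> \<le> B * s + B * s"
    using prim_bound[OF assms(2,4) s(1)] mean_bound[OF assms(1,2,4)] s(1)
    by (intro add_mono mult_right_mono) auto
  also have "\<dots> \<le> B * L + B * L"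
    using s(2) \<open>0 \<le> B\<close> by (intro add_mono mult_left_mono)
  finally show ?thesis using s(3) by (simp add: mult_ac)
qed

lemma osc_derivative:
  assumes "continuous_on UNIV f" "\<And>x. (F has_real_derivative f x) (at x)" "periodic L F"
  shows "osc L f x = F x - F 0"
  using mean_derivative[OF assms] prim_unique[OF assms(1,2)] by (simp add: osc_def)

section \<open>A Newton step for nearly affine mean equations\<close>

text \<open>\<open>n t\<close> stands for the derivative of \<open>N t\<close> at 0.
  \<open>N_linear\<close> bounds the second-order remainder in difference form: on arguments of size
  e it has Lipschitz constant \<open>M * e\<close>, and this factor makes the Newton step nearly
  independent of its starting value. \<open>r_le_1\<close> lets a product of two small quantities be
  absorbed into one of them.\<close>

locale periodic_nonlinearity =
  fixes L r M :: real and N :: "real \<Rightarrow> real \<Rightarrow> real" and n :: "real \<Rightarrow> real"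
  assumes L_pos: "0 < L" and r_pos: "0 < r" and M_pos: "0 < M" and r_le_1: "r \<le> 1"
    and cont_N: "continuous_on (UNIV \<times> {-r..r}) (\<lambda>(t, x). N t x)"
    and cont_n: "continuous_on UNIV n"
    and periodic_N: "\<bar>x\<bar> \<le> r \<Longrightarrow> N (t + L) x = N t x"
    and N_0: "\<bar>N t 0\<bar> \<le> M"
    and n_bound: "\<bar>n t\<bar> \<le> M"
    and N_linear: "\<bar>x\<bar> \<le> e \<Longrightarrow> \<bar>y\<bar> \<le> e \<Longrightarrow> e \<le> r \<Longrightarrow>
      \<bar>N t x - N t y - n t * (x - y)\<bar> \<le> M * e * \<bar>x - y\<bar>"
    and mean_N_0: "mean L (\<lambda>t. N t 0) = 0"
    and mean_n: "mean L n \<noteq> 0"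
begin

lemma cont_comp:
  assumes "continuous_on UNIV f" "\<And>t. \<bar>f t\<bar> \<le> r"
  shows "continuous_on UNIV (\<lambda>t. N t (f t))"
proof -
  have "f t \<in> {-r..r}" for t
    using assms(2)[of t] by auto
  then have "(\<lambda>t. (t, f t)) ` UNIV \<subseteq> UNIV \<times> {-r..r}"
    by blast
  then have "continuous_on UNIV ((\<lambda>(t, x). N t x) \<circ> (\<lambda>t. (t, f t)))"
    using assms(1)
    by (intro continuous_on_compose continuous_on_subset[OF cont_N] continuous_intros)
  then show ?thesis by (simp add: o_def)
qed

text \<open>The case \<open>e = r\<close> of \<open>N_linear\<close>; as \<open>r\<close> is at most
  1, remainder and linear part each cost one \<open>M\<close>.\<close>

lemma lipschitz:
  assumes "\<bar>x\<bar> \<le> r" "\<bar>y\<bar> \<le> r"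
  shows "\<bar>N t x - N t y\<bar> \<le> 2 * M * \<bar>x - y\<bar>"
proof -
  have "\<bar>N t x - N t y\<bar> \<le> \<bar>N t x - N t y - n t * (x - y)\<bar> + \<bar>n t\<bar> * \<bar>x - y\<bar>"
    by (simp flip: abs_mult)
  also have "\<dots> \<le> M * r * \<bar>x - y\<bar> + M * \<bar>x - y\<bar>"
    using N_linear[OF assms order_refl] n_bound by (intro add_mono mult_right_mono) auto
  also have "\<dots> \<le> M * 1 * \<bar>x - y\<bar> + M * \<bar>x - y\<bar>"
    using M_pos r_le_1 by (intro add_mono mult_right_mono mult_left_mono) auto
  finally show ?thesis by simp
qed

text \<open>The unknown is a constant added to \<open>f\<close>, and \<open>s\<close> is a guess of
  it. The derivative in the Newton step is frozen at \<open>mean L n\<close>, its value along the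
  zero function; iterating the step together with \<open>f\<close> replaces an implicit choice of
  the constant.\<close>

definition correction :: "real \<Rightarrow> (real \<Rightarrow> real) \<Rightarrow> real \<Rightarrow> real" where
  "correction s f t = s - mean L (\<lambda>t. N t (s + f t)) / mean L n + f t"

lemma continuous_correction [continuous_intros]:
  assumes "continuous_on S f"
  shows "continuous_on S (correction s f)"
  unfolding correction_def[abs_def] by (intro continuous_intros assms)

lemma periodic_correction:
  assumes "periodic L f"
  shows "periodic L (correction s f)"
  using assms by (simp add: periodic_def correction_def)

text \<open>The step \<open>s - mean/n\<close> is a Newton step at a nearly affine equation, so the derivative of the
  result with respect to \<open>s\<close> is of the size \<open>e\<close> of the arguments.\<close>

lemma correction_diff:
  assumes f: "continuous_on UNIV f" "continuous_on UNIV g"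
    and fg: "\<And>t. \<bar>f t - g t\<bar> \<le> b" and D: "\<bar>s - s'\<bar> \<le> D"
    and e: "\<And>t. \<bar>s + f t\<bar> \<le> e" "\<And>t. \<bar>s' + g t\<bar> \<le> e" "e \<le> r"
  shows "\<bar>correction s f t - correction s' g t\<bar> \<le> (1 + 2 * M / \<bar>mean L n\<bar>) * (b + e * D)"
proof -
  let ?\<Delta> = "\<lambda>t. N t (s + f t) - N t (s' + g t)"
  have er: "\<And>t. \<bar>s + f t\<bar> \<le> r" "\<And>t. \<bar>s' + g t\<bar> \<le> r"
    using order_trans[OF e(1) e(3)] order_trans[OF e(2) e(3)] by auto
  have nonneg: "0 \<le> b" "0 \<le> D" "0 \<le> e"
    using fg[of 0] D e(1)[of 0] by linarith+
  have cont: "continuous_on UNIV (\<lambda>t. N t (s + f t))" "continuous_on UNIV (\<lambda>t. N t (s' + g t))"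
    using f er by (auto intro!: cont_comp continuous_intros)
  have "\<bar>?\<Delta> t - n t * (s - s')\<bar> \<le> 2 * M * (b + e * D)" for t
  proof -
    let ?d = "(s + f t) - (s' + g t)"
    \<comment> \<open>Add and subtract \<open>n t * (f t - g t)\<close>: \<open>N_linear\<close>
      handles the remainder at \<open>?d\<close>, and the bound on \<open>n\<close> the
      rest.\<close>
    have "\<bar>?\<Delta> t - n t * (s - s')\<bar> \<le> \<bar>?\<Delta> t - n t * ?d\<bar> + \<bar>n t\<bar> * \<bar>f t - g t\<bar>"
      unfolding abs_mult[symmetric] by (rule order_trans[OF _ abs_triangle_ineq]) (simp add: algebra_simps)
    also have "\<dots> \<le> M * e * \<bar>?d\<bar> + M * b"
      using N_linear[OF e(1)[of t] e(2)[of t] e(3), of t] n_bound[of t] fg[of t] M_pos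
      by (intro add_mono mult_mono) auto
    also have "\<dots> \<le> M * e * (D + b) + M * b"
      using fg[of t] D M_pos nonneg by (intro add_mono mult_left_mono) auto
    also have "\<dots> = M * (b + e * D) + M * (e * b)"
      by (simp add: algebra_simps)
    \<comment> \<open>\<open>e * b \<le> b\<close> because \<open>e \<le> r \<le> 1\<close>; this
      absorption produces the factor 2.\<close>
    also have "\<dots> \<le> M * (b + e * D) + M * (b + e * D)"
      using M_pos nonneg e(3) r_le_1 mult_left_le_one_le[of b e]
      by (intro add_mono mult_left_mono) (auto intro!: add_increasing2)
    finally show ?thesis by simp
  qed
  then have "\<bar>mean L (\<lambda>t. ?\<Delta> t - n t * (s - s'))\<bar> \<le> 2 * M * (b + e * D)"
    by (intro mean_bound continuous_intros cont cont_n L_pos)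
  also have "mean L (\<lambda>t. ?\<Delta> t - n t * (s - s')) =
      mean L (\<lambda>t. N t (s + f t)) - mean L (\<lambda>t. N t (s' + g t)) - (s - s') * mean L n"
    using mean_cmult[OF cont_n, of L "s - s'"]
    by (simp add: mean_diff cont cont_n continuous_intros mult.commute)
  finally have "\<bar>mean L (\<lambda>t. N t (s + f t)) - mean L (\<lambda>t. N t (s' + g t)) - (s - s') * mean L n\<bar>
      / \<bar>mean L n\<bar> \<le> 2 * M * (b + e * D) / \<bar>mean L n\<bar>"
    by (rule divide_right_mono) simp
  \<comment> \<open>The difference \<open>s - s'\<close> cancels against
    \<open>(s - s') * mean L n / mean L n\<close>, so the new constants differ only by the nonlinear
    defect.\<close>
  moreover have "correction s f t - correction s' g t = (f t - g t) -
      (mean L (\<lambda>t. N t (s + f t)) - mean L (\<lambda>t. N t (s' + g t)) - (s - s') * mean L n) / mean L n"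
    using mean_n by (simp add: correction_def diff_divide_distrib)
  then have "\<bar>correction s f t - correction s' g t\<bar> \<le> \<bar>f t - g t\<bar> +
      \<bar>mean L (\<lambda>t. N t (s + f t)) - mean L (\<lambda>t. N t (s' + g t)) - (s - s') * mean L n\<bar> / \<bar>mean L n\<bar>"
    unfolding abs_divide[symmetric] by (metis abs_triangle_ineq4)
  ultimately have "\<bar>correction s f t - correction s' g t\<bar>
      \<le> b + 2 * M * (b + e * D) / \<bar>mean L n\<bar>"
    using fg[of t] by linarith
  also have "\<dots> \<le> (b + e * D) + 2 * M * (b + e * D) / \<bar>mean L n\<bar>"
    using nonneg by simp
  also have "\<dots> = (1 + 2 * M / \<bar>mean L n\<bar>) * (b + e * D)"
    by (simp add: algebra_simps)
  finally show ?thesis .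
qed

text \<open>This is \<open>correction_diff\<close> against \<open>s' = 0\<close> and the zero
  function, whose correction vanishes because of \<open>mean_N_0\<close>.\<close>

lemma correction_bound:
  assumes f: "continuous_on UNIV f"
    and b: "\<And>t. \<bar>f t\<bar> \<le> b" and D: "\<bar>s\<bar> \<le> D" and e: "D + b \<le> e" "e \<le> r"
  shows "\<bar>correction s f t\<bar> \<le> (1 + 2 * M / \<bar>mean L n\<bar>) * (b + e * D)"
proof -
  have "\<bar>s + f t\<bar> \<le> e" for t using b[of t] D e by linarith
  moreover have "0 \<le> e" using b[of 0] D e by linarith
  moreover have "correction 0 (\<lambda>t. 0) t = 0"
    by (simp add: correction_def mean_N_0)
  ultimately show ?thesis
    using correction_diff[OF f continuous_on_const[of UNIV 0], of b s 0 D e t] b D e(2) by auto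
qed

text \<open>At t = 0 the function \<open>f\<close> vanishes, so the fixed-point equation there says
  that the Newton increment is 0. This is why the step starts from the value of the unknown function
  at 0.\<close>

lemma correction_fixed:
  assumes "\<And>t. correction (x 0) f t = x t" "f 0 = 0"
  shows "mean L (\<lambda>t. N t (x t)) = 0" "x t = x 0 + f t"
proof -
  have "mean L (\<lambda>t. N t (x 0 + f t)) = 0"
    using assms(1)[of 0] mean_n assms(2) by (simp add: correction_def)
  then show x: "x t = x 0 + f t" for t
    using assms(1)[of t] by (simp add: correction_def)
  then have "mean L (\<lambda>t. N t (x t)) = mean L (\<lambda>t. N t (x 0 + f t))"
    by (intro arg_cong[of _ _ "mean L"] ext arg_cong[of _ _ "N _"])
  with \<open>mean L (\<lambda>t. N t (x 0 + f t)) = 0\<close> show "mean L (\<lambda>t. N t (x t)) = 0"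
    by (rule trans[rotated])
qed

lemma correction_eq:
  assumes "\<And>t. x t = x 0 + f t" "mean L (\<lambda>t. N t (x t)) = 0"
  shows "correction (x 0) f t = x t"
proof -
  have "mean L (\<lambda>t. N t (x t)) = mean L (\<lambda>t. N t (x 0 + f t))"
    by (intro arg_cong[of _ _ "mean L"] ext arg_cong[of _ _ "N _"]) (rule assms(1))
  then have "mean L (\<lambda>t. N t (x 0 + f t)) = 0" using assms(2) by (rule trans[OF sym])
  then show ?thesis unfolding correction_def using assms(1)[of t] by simp
qed

end

section \<open>Periodic solutions of weakly coupled equations\<close>

text \<open>\<open>P_0\<close> says that y = 0 keeps x constant. Hence x' is bounded by a multiple
  of |y|, which supplies the smallness that the first equation lacks.\<close>

locale coupled_nonlinearities =
  P: periodic_nonlinearity L r M P p + Q: periodic_nonlinearity L r M Q q for L r M P p Q q +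
  assumes P_0 [simp]: "P t 0 = 0"
begin

text \<open>A common bound for the factors in front of \<open>b + e * D\<close> in
  \<open>correction_diff\<close>, for both Newton steps.\<close>

definition A :: real where
  "A = 1 + 2 * M / \<bar>mean L p\<bar> + 2 * M / \<bar>mean L q\<bar>"

text \<open>The size of the updated y in units of |\<epsilon>|: inside the parentheses,
  \<open>6 * L * M\<close> comes from integrating a forcing bounded by \<open>3 * M\<close>, and 1
  from the second-order term of the Newton step.\<close>

definition By :: real where "By = A * (6 * L * M + 1)"

text \<open>The size of \<open>osc\<close> of P along the updated y in units of |\<epsilon>|:
  \<open>2 * L\<close> from \<open>osc_bound\<close>, times the Lipschitz constant
  \<open>2 * M\<close>, times \<open>By\<close>.\<close>

definition Bx :: real where "Bx = 4 * L * M * By"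

definition solves :: "real \<Rightarrow> (real \<Rightarrow> real) \<Rightarrow> (real \<Rightarrow> real) \<Rightarrow> bool" where
  "solves \<epsilon> x y \<longleftrightarrow> (\<forall>t. (x has_real_derivative P t (y t)) (at t) \<and>
     (y has_real_derivative \<epsilon> * Q t (x t)) (at t))"

definition admissible :: "real \<Rightarrow> (real \<Rightarrow> real) \<Rightarrow> bool" where
  "admissible \<rho> x \<longleftrightarrow> continuous_on UNIV x \<and> periodic L x \<and> (\<forall>t. \<bar>x t\<bar> \<le> \<rho>)"

lemma admissible_le: "admissible \<rho> x \<Longrightarrow> \<rho> \<le> a \<Longrightarrow> \<bar>x t\<bar> \<le> a"
  unfolding admissible_def using order_trans by blast

lemma admissibleD:
  assumes "admissible \<rho> x"
  shows "continuous_on UNIV x" "periodic L x" "\<bar>x t\<bar> \<le> \<rho>"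
  using assms by (auto simp: admissible_def)

lemma A_ge_1: "1 \<le> A"
  using P.M_pos by (simp add: A_def)

lemma A_ge: "1 + 2 * M / \<bar>mean L p\<bar> \<le> A" "1 + 2 * M / \<bar>mean L q\<bar> \<le> A"
  using P.M_pos by (simp_all add: A_def)

lemma By_pos: "0 < By"
  using A_ge_1 P.L_pos P.M_pos by (auto simp: By_def intro!: mult_pos_pos add_pos_pos)

lemma Bx_pos: "0 < Bx"
  using By_pos P.L_pos P.M_pos by (simp add: Bx_def)

text \<open>Solvability of the equation for x fixes the constant of y, hence a correction with
  respect to P; of the old y only the value at 0 enters.\<close>

definition ystep :: "real \<Rightarrow> (real \<Rightarrow> real) \<Rightarrow> (real \<Rightarrow> real) \<Rightarrow> real \<Rightarrow> real" where
  "ystep \<epsilon> x y = P.correction (y 0) (osc L (\<lambda>t. \<epsilon> * Q t (x t)))"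

text \<open>The updated y, and not the old one, enters P: with the old y the Lipschitz constant of
  this step would be of order 1, since P carries no factor \<epsilon>.\<close>

definition xstep :: "real \<Rightarrow> (real \<Rightarrow> real) \<Rightarrow> (real \<Rightarrow> real) \<Rightarrow> real \<Rightarrow> real" where
  "xstep \<epsilon> x y = Q.correction (x 0) (osc L (\<lambda>t. P t (ystep \<epsilon> x y t)))"

end

text \<open>The conditions in order: the arguments of both nonlinearities stay within
  \<open>r\<close>; the second-order terms of the Newton steps are at most |\<epsilon>|; the updated
  y stays within \<open>r\<close>; each of the two steps contracts by 1/4.\<close>

locale small_coupling = coupled_nonlinearities +
  fixes R \<epsilon> :: real
  assumes R_nonneg: "0 \<le> R"
    and small: "(R + 6 * L * M + Bx) * \<bar>\<epsilon>\<bar> \<le> r" "(R + 6 * L * M + Bx) * R * \<bar>\<epsilon>\<bar> \<le> 1"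
      "By * \<bar>\<epsilon>\<bar> \<le> r" "A * (10 * L * M + R) * \<bar>\<epsilon>\<bar> \<le> 1 / 4"
      "A * (4 * L * M * (A * (10 * L * M + R)) + R + Bx) * \<bar>\<epsilon>\<bar> \<le> 1 / 4"
begin

abbreviation "\<rho> \<equiv> R * \<bar>\<epsilon>\<bar>"

lemma LM_pos: "0 < L * M"
  using P.L_pos P.M_pos by simp

text \<open>The products in the last two bounds are the terms \<open>e * D\<close> of
  \<open>correction_bound\<close>. They are quadratic in \<epsilon>, so a small \<epsilon> outweighs
  the large constant \<open>R\<close>. This makes the sizes of the steps independent of
  \<open>R\<close>, which can then be chosen above them.\<close>

lemma sizes: "\<rho> \<le> r" "\<rho> + 6 * L * M * \<bar>\<epsilon>\<bar> \<le> r" "\<rho> + Bx * \<bar>\<epsilon>\<bar> \<le> r"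
  "(\<rho> + 6 * L * M * \<bar>\<epsilon>\<bar>) * \<rho> \<le> \<bar>\<epsilon>\<bar>" "(\<rho> + Bx * \<bar>\<epsilon>\<bar>) * \<rho> \<le> \<bar>\<epsilon>\<bar>"
proof -
  have nonneg: "0 \<le> L * M * \<bar>\<epsilon>\<bar>" "0 \<le> Bx * \<bar>\<epsilon>\<bar>" "0 \<le> \<rho>"
    using LM_pos Bx_pos R_nonneg by auto
  have eq: "(R + 6 * L * M + Bx) * \<bar>\<epsilon>\<bar> = \<rho> + 6 * (L * M * \<bar>\<epsilon>\<bar>) + Bx * \<bar>\<epsilon>\<bar>"
    by (simp add: algebra_simps)
  show "\<rho> \<le> r" "\<rho> + 6 * L * M * \<bar>\<epsilon>\<bar> \<le> r" "\<rho> + Bx * \<bar>\<epsilon>\<bar> \<le> r"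
    using nonneg small(1) unfolding eq by (simp_all add: mult.assoc)
  have "(\<rho> + 6 * (L * M * \<bar>\<epsilon>\<bar>) + Bx * \<bar>\<epsilon>\<bar>) * \<rho> = ((R + 6 * L * M + Bx) * R * \<bar>\<epsilon>\<bar>) * \<bar>\<epsilon>\<bar>"
    by (simp add: algebra_simps)
  also have "\<dots> \<le> 1 * \<bar>\<epsilon>\<bar>"
    by (rule mult_right_mono[OF small(2)]) simp
  finally have *: "(\<rho> + 6 * (L * M * \<bar>\<epsilon>\<bar>) + Bx * \<bar>\<epsilon>\<bar>) * \<rho> \<le> \<bar>\<epsilon>\<bar>"
    by simp
  have "(\<rho> + 6 * L * M * \<bar>\<epsilon>\<bar>) * \<rho> \<le> (\<rho> + 6 * (L * M * \<bar>\<epsilon>\<bar>) + Bx * \<bar>\<epsilon>\<bar>) * \<rho>"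
    "(\<rho> + Bx * \<bar>\<epsilon>\<bar>) * \<rho> \<le> (\<rho> + 6 * (L * M * \<bar>\<epsilon>\<bar>) + Bx * \<bar>\<epsilon>\<bar>) * \<rho>"
    using nonneg by (auto intro!: mult_right_mono)
  then show "(\<rho> + 6 * L * M * \<bar>\<epsilon>\<bar>) * \<rho> \<le> \<bar>\<epsilon>\<bar>" "(\<rho> + Bx * \<bar>\<epsilon>\<bar>) * \<rho> \<le> \<bar>\<epsilon>\<bar>"
    using * by linarith+
qed

lemma By_small: "By * \<bar>\<epsilon>\<bar> \<le> r"
  by (rule small(3))

section \<open>Sizes of the forcings and of the two steps\<close>

lemma Q_forcing:
  assumes "admissible \<rho> x"
  shows "continuous_on UNIV (\<lambda>t. \<epsilon> * Q t (x t))" "periodic L (\<lambda>t. \<epsilon> * Q t (x t))"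
    "\<bar>\<epsilon> * Q t (x t)\<bar> \<le> 3 * M * \<bar>\<epsilon>\<bar>"
    "\<bar>osc L (\<lambda>t. \<epsilon> * Q t (x t)) t\<bar> \<le> 6 * L * M * \<bar>\<epsilon>\<bar>"
proof -
  have x: "continuous_on UNIV x" "periodic L x" "\<And>t. \<bar>x t\<bar> \<le> \<rho>" "\<And>t. \<bar>x t\<bar> \<le> r"
    using admissibleD[OF assms] admissible_le[OF assms sizes(1)] by auto
  show c: "continuous_on UNIV (\<lambda>t. \<epsilon> * Q t (x t))"
    by (intro continuous_intros Q.cont_comp x)
  show per: "periodic L (\<lambda>t. \<epsilon> * Q t (x t))"
    using x Q.periodic_N by (simp add: periodic_def)
  show b: "\<bar>\<epsilon> * Q t (x t)\<bar> \<le> 3 * M * \<bar>\<epsilon>\<bar>" for t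
  proof -
    have "\<bar>x t\<bar> \<le> 1" using x(4)[of t] P.r_le_1 by linarith
    then have "2 * M * \<bar>x t\<bar> \<le> 2 * M"
      using P.M_pos by simp
    moreover have "\<bar>Q t (x t) - Q t 0\<bar> \<le> 2 * M * \<bar>x t\<bar>"
      using Q.lipschitz[OF x(4), of 0 t t] P.r_pos by simp
    \<comment> \<open>One \<open>M\<close> is the size of \<open>Q t 0\<close>, two come from the
      Lipschitz bound with \<open>\<bar>x t\<bar> \<le> 1\<close>.\<close>
    ultimately have "\<bar>Q t (x t)\<bar> \<le> 3 * M"
      using Q.N_0[of t] by linarith
    from mult_left_mono[OF this, of "\<bar>\<epsilon>\<bar>"] show ?thesis
      by (simp add: abs_mult mult_ac)
  qed
  show "\<bar>osc L (\<lambda>t. \<epsilon> * Q t (x t)) t\<bar> \<le> 6 * L * M * \<bar>\<epsilon>\<bar>"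
    using osc_bound[OF P.L_pos c per b, of t] by (simp add: mult_ac)
qed

lemma ystep_admissible:
  assumes x: "admissible \<rho> x" and y: "admissible \<rho> y"
  shows "admissible (By * \<bar>\<epsilon>\<bar>) (ystep \<epsilon> x y)"
proof -
  note f = Q_forcing[OF x]
  have "\<bar>ystep \<epsilon> x y t\<bar> \<le> By * \<bar>\<epsilon>\<bar>" for t
  proof -
    have "\<bar>ystep \<epsilon> x y t\<bar> \<le> (1 + 2 * M / \<bar>mean L p\<bar>) *
        (6 * L * M * \<bar>\<epsilon>\<bar> + (\<rho> + 6 * L * M * \<bar>\<epsilon>\<bar>) * \<rho>)"
      unfolding ystep_def using f y sizes
      by (intro P.correction_bound continuous_osc) (auto simp: admissible_def)
    also have "\<dots> \<le> A * (6 * L * M * \<bar>\<epsilon>\<bar> + \<bar>\<epsilon>\<bar>)"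
      using A_ge(1) A_ge_1 sizes(4) R_nonneg P.L_pos P.M_pos
      by (intro mult_mono add_left_mono add_nonneg_nonneg mult_nonneg_nonneg) auto
    finally show ?thesis by (simp add: By_def algebra_simps)
  qed
  then show ?thesis
    unfolding admissible_def using f P.L_pos
    by (auto simp: ystep_def intro!: P.continuous_correction continuous_osc P.periodic_correction periodic_osc)
qed

lemma P_forcing:
  assumes y: "admissible (By * \<bar>\<epsilon>\<bar>) y"
  shows "continuous_on UNIV (\<lambda>t. P t (y t))" "periodic L (\<lambda>t. P t (y t))"
    "\<bar>osc L (\<lambda>t. P t (y t)) t\<bar> \<le> Bx * \<bar>\<epsilon>\<bar>"
proof -
  have y: "continuous_on UNIV y" "periodic L y" "\<And>t. \<bar>y t\<bar> \<le> By * \<bar>\<epsilon>\<bar>" "\<And>t. \<bar>y t\<bar> \<le> r"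
    using admissibleD[OF assms] admissible_le[OF assms By_small] by auto
  show c: "continuous_on UNIV (\<lambda>t. P t (y t))"
    by (intro continuous_intros P.cont_comp y)
  show per: "periodic L (\<lambda>t. P t (y t))"
    using y P.periodic_N by (simp add: periodic_def)
  have b: "\<bar>P t (y t)\<bar> \<le> 2 * M * (By * \<bar>\<epsilon>\<bar>)" for t
  proof -
    \<comment> \<open>\<open>P_0\<close> turns the Lipschitz bound into a bound of P by y, so the
      factor |\<epsilon>| is inherited from y.\<close>
    have "\<bar>P t (y t)\<bar> \<le> 2 * M * \<bar>y t\<bar>"
      using P.lipschitz[OF y(4), of 0 t t] P.r_pos by simp
    also have "\<dots> \<le> 2 * M * (By * \<bar>\<epsilon>\<bar>)"
      using y(3) P.M_pos by (intro mult_left_mono) auto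
    finally show ?thesis .
  qed
  show "\<bar>osc L (\<lambda>t. P t (y t)) t\<bar> \<le> Bx * \<bar>\<epsilon>\<bar>"
    using osc_bound[OF P.L_pos c per b, of t] by (simp add: Bx_def mult_ac)
qed

lemma xstep_admissible:
  assumes x: "admissible \<rho> x" and y: "admissible \<rho> y"
  shows "admissible (A * (Bx + 1) * \<bar>\<epsilon>\<bar>) (xstep \<epsilon> x y)"
proof -
  note f = P_forcing[OF ystep_admissible[OF x y]]
  have "\<bar>xstep \<epsilon> x y t\<bar> \<le> A * (Bx + 1) * \<bar>\<epsilon>\<bar>" for t
  proof -
    have "\<bar>xstep \<epsilon> x y t\<bar> \<le> (1 + 2 * M / \<bar>mean L q\<bar>) *
        (Bx * \<bar>\<epsilon>\<bar> + (\<rho> + Bx * \<bar>\<epsilon>\<bar>) * \<rho>)"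
      unfolding xstep_def using f x sizes
      by (intro Q.correction_bound continuous_osc) (auto simp: admissible_def)
    also have "\<dots> \<le> A * (Bx * \<bar>\<epsilon>\<bar> + \<bar>\<epsilon>\<bar>)"
      using A_ge(2) A_ge_1 sizes(5) R_nonneg Bx_pos
      by (intro mult_mono add_left_mono add_nonneg_nonneg mult_nonneg_nonneg) auto
    finally show ?thesis by (simp add: algebra_simps)
  qed
  then show ?thesis
    unfolding admissible_def using f P.L_pos
    by (auto simp: xstep_def intro!: Q.continuous_correction continuous_osc Q.periodic_correction periodic_osc)
qed

section \<open>Lipschitz constants of the two steps\<close>

context
  fixes x y x' y' :: "real \<Rightarrow> real" and D :: real
  assumes adm: "admissible \<rho> x" "admissible \<rho> y" "admissible \<rho> x'" "admissible \<rho> y'"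
    and close: "\<And>t. \<bar>x t - x' t\<bar> \<le> D" "\<And>t. \<bar>y t - y' t\<bar> \<le> D"
begin

text \<open>\<open>10 * L * M + R\<close> collects \<open>4 * L * M\<close> from the oscillation of
  the forcing difference and \<open>6 * L * M + R\<close> from the radius of the arguments, which is
  the factor \<open>e\<close> of \<open>correction_diff\<close>.\<close>

lemma ystep_diff: "\<bar>ystep \<epsilon> x y t - ystep \<epsilon> x' y' t\<bar> \<le> A * (10 * L * M + R) * \<bar>\<epsilon>\<bar> * D"
proof -
  note f = Q_forcing[OF adm(1)] and f' = Q_forcing[OF adm(3)]
  have "0 \<le> D" using close(1)[of 0] by linarith
  have d: "\<bar>\<epsilon> * Q t (x t) - \<epsilon> * Q t (x' t)\<bar> \<le> 2 * M * \<bar>\<epsilon>\<bar> * D" for t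
  proof -
    have "\<bar>x t\<bar> \<le> r" "\<bar>x' t\<bar> \<le> r"
      using admissible_le[OF adm(1) sizes(1)] admissible_le[OF adm(3) sizes(1)] by auto
    then have "\<bar>Q t (x t) - Q t (x' t)\<bar> \<le> 2 * M * \<bar>x t - x' t\<bar>"
      by (rule Q.lipschitz)
    also have "\<dots> \<le> 2 * M * D"
      using close(1) P.M_pos by (intro mult_left_mono) auto
    finally have "\<bar>Q t (x t) - Q t (x' t)\<bar> \<le> 2 * M * D" .
    then have "\<bar>\<epsilon>\<bar> * \<bar>Q t (x t) - Q t (x' t)\<bar> \<le> \<bar>\<epsilon>\<bar> * (2 * M * D)"
      by (rule mult_left_mono) simp
    then show ?thesis by (simp add: mult_ac flip: abs_mult right_diff_distrib)
  qed
  have per: "periodic L (\<lambda>t. \<epsilon> * Q t (x t) - \<epsilon> * Q t (x' t))"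
    using f(2) f'(2) unfolding periodic_def by metis
  have "\<bar>osc L (\<lambda>t. \<epsilon> * Q t (x t)) t - osc L (\<lambda>t. \<epsilon> * Q t (x' t)) t\<bar>
      \<le> 4 * L * M * \<bar>\<epsilon>\<bar> * D" for t
    using osc_bound[OF P.L_pos continuous_on_diff[OF f(1) f'(1)] per d, of t]
    by (simp add: osc_diff[OF f(1) f'(1)] mult_ac)
  moreover have "\<bar>y 0 + osc L (\<lambda>t. \<epsilon> * Q t (x t)) t\<bar> \<le> \<rho> + 6 * L * M * \<bar>\<epsilon>\<bar>"
    "\<bar>y' 0 + osc L (\<lambda>t. \<epsilon> * Q t (x' t)) t\<bar> \<le> \<rho> + 6 * L * M * \<bar>\<epsilon>\<bar>" for t
    using admissibleD(3)[OF adm(2), of 0] admissibleD(3)[OF adm(4), of 0] f(4)[of t] f'(4)[of t]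
    by linarith+
  ultimately have "\<bar>ystep \<epsilon> x y t - ystep \<epsilon> x' y' t\<bar> \<le> (1 + 2 * M / \<bar>mean L p\<bar>) *
      (4 * L * M * \<bar>\<epsilon>\<bar> * D + (\<rho> + 6 * L * M * \<bar>\<epsilon>\<bar>) * D)"
    unfolding ystep_def by (intro P.correction_diff continuous_osc f(1) f'(1) close(2) sizes(2))
  also have "\<dots> = (1 + 2 * M / \<bar>mean L p\<bar>) * ((10 * L * M + R) * \<bar>\<epsilon>\<bar> * D)"
    by (simp add: algebra_simps)
  also have "\<dots> \<le> A * ((10 * L * M + R) * \<bar>\<epsilon>\<bar> * D)"
    using A_ge(1) R_nonneg P.L_pos P.M_pos \<open>0 \<le> D\<close>
    by (intro mult_right_mono add_nonneg_nonneg mult_nonneg_nonneg) auto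
  finally show ?thesis by (simp add: mult_ac)
qed

text \<open>The bound \<open>ystep_diff\<close> enters through \<open>osc\<close> with the factor
  \<open>4 * L * M\<close>; \<open>R + Bx\<close> is the radius of the arguments in the Newton
  step.\<close>

lemma xstep_diff:
  "\<bar>xstep \<epsilon> x y t - xstep \<epsilon> x' y' t\<bar>
     \<le> A * (4 * L * M * (A * (10 * L * M + R)) + R + Bx) * \<bar>\<epsilon>\<bar> * D"
proof -
  let ?b = "A * (10 * L * M + R) * \<bar>\<epsilon>\<bar> * D"
  note z = ystep_admissible[OF adm(1,2)] and z' = ystep_admissible[OF adm(3,4)]
  note f = P_forcing[OF z] and f' = P_forcing[OF z']
  have "0 \<le> D" using close(1)[of 0] by linarith
  have d: "\<bar>P t (ystep \<epsilon> x y t) - P t (ystep \<epsilon> x' y' t)\<bar> \<le> 2 * M * ?b" for t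
  proof -
    have "\<bar>ystep \<epsilon> x y t\<bar> \<le> r" "\<bar>ystep \<epsilon> x' y' t\<bar> \<le> r"
      using admissible_le[OF z By_small] admissible_le[OF z' By_small] by auto
    then have "\<bar>P t (ystep \<epsilon> x y t) - P t (ystep \<epsilon> x' y' t)\<bar>
        \<le> 2 * M * \<bar>ystep \<epsilon> x y t - ystep \<epsilon> x' y' t\<bar>"
      by (rule P.lipschitz)
    also have "\<dots> \<le> 2 * M * ?b"
      using ystep_diff P.M_pos by (intro mult_left_mono) auto
    finally show ?thesis .
  qed
  have per: "periodic L (\<lambda>t. P t (ystep \<epsilon> x y t) - P t (ystep \<epsilon> x' y' t))"
    using f(2) f'(2) unfolding periodic_def by metis
  have "\<bar>osc L (\<lambda>t. P t (ystep \<epsilon> x y t)) t - osc L (\<lambda>t. P t (ystep \<epsilon> x' y' t)) t\<bar>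
      \<le> 4 * L * M * ?b" for t
    using osc_bound[OF P.L_pos continuous_on_diff[OF f(1) f'(1)] per d, of t]
    by (simp add: osc_diff[OF f(1) f'(1)] algebra_simps)
  moreover have "\<bar>x 0 + osc L (\<lambda>t. P t (ystep \<epsilon> x y t)) t\<bar> \<le> \<rho> + Bx * \<bar>\<epsilon>\<bar>"
    "\<bar>x' 0 + osc L (\<lambda>t. P t (ystep \<epsilon> x' y' t)) t\<bar> \<le> \<rho> + Bx * \<bar>\<epsilon>\<bar>" for t
    using admissibleD(3)[OF adm(1), of 0] admissibleD(3)[OF adm(3), of 0] f(3)[of t] f'(3)[of t]
    by linarith+
  ultimately have "\<bar>xstep \<epsilon> x y t - xstep \<epsilon> x' y' t\<bar> \<le> (1 + 2 * M / \<bar>mean L q\<bar>) *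
      (4 * L * M * ?b + (\<rho> + Bx * \<bar>\<epsilon>\<bar>) * D)"
    unfolding xstep_def by (intro Q.correction_diff continuous_osc f(1) f'(1) close(1) sizes(3))
  also have "\<dots> = (1 + 2 * M / \<bar>mean L q\<bar>) *
      ((4 * (L * M) * (A * (10 * (L * M) + R)) + R + Bx) * \<bar>\<epsilon>\<bar> * D)"
    by (simp add: algebra_simps)
  also have "\<dots> \<le> A * ((4 * (L * M) * (A * (10 * (L * M) + R)) + R + Bx) * \<bar>\<epsilon>\<bar> * D)"
    using A_ge(2) A_ge_1 R_nonneg P.L_pos P.M_pos Bx_pos \<open>0 \<le> D\<close>
    by (intro mult_right_mono add_nonneg_nonneg mult_nonneg_nonneg) auto
  finally show ?thesis by (simp add: algebra_simps)
qed

lemma step_contraction: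
  "\<bar>xstep \<epsilon> x y t - xstep \<epsilon> x' y' t\<bar> \<le> D / 4" "\<bar>ystep \<epsilon> x y t - ystep \<epsilon> x' y' t\<bar> \<le> D / 4"
proof -
  have "0 \<le> D" using close(1)[of 0] by linarith
  show "\<bar>xstep \<epsilon> x y t - xstep \<epsilon> x' y' t\<bar> \<le> D / 4"
    using xstep_diff[of t] mult_right_mono[OF small(5) \<open>0 \<le> D\<close>] by simp
  show "\<bar>ystep \<epsilon> x y t - ystep \<epsilon> x' y' t\<bar> \<le> D / 4"
    using ystep_diff[of t] mult_right_mono[OF small(4) \<open>0 \<le> D\<close>] by simp
qed

end

text \<open>A periodic solution is its initial value plus \<open>osc\<close> of its right-hand side,
  and the means vanish by periodicity; a fixed point yields both facts through
  \<open>correction_fixed\<close>. At \<epsilon> = 0 the equivalence breaks down: a constant x with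
  y = 0 solves the equations, but the mean of Q along it need not vanish.\<close>

lemma solves_iff_fixed:
  assumes "\<epsilon> \<noteq> 0" and adm: "admissible \<rho> x" "admissible \<rho> y"
  shows "solves \<epsilon> x y \<longleftrightarrow> xstep \<epsilon> x y = x \<and> ystep \<epsilon> x y = y"
proof
  note fQ = Q_forcing[OF adm(1)]
  have y: "continuous_on UNIV y" "periodic L y" "\<And>t. \<bar>y t\<bar> \<le> r"
    using admissibleD[OF adm(2)] admissible_le[OF adm(2) sizes(1)] by auto
  have fP: "continuous_on UNIV (\<lambda>t. P t (y t))"
    by (intro P.cont_comp y)
  have x: "periodic L x" "\<And>t. \<bar>x t\<bar> \<le> r" "continuous_on UNIV x"
    using admissibleD[OF adm(1)] admissible_le[OF adm(1) sizes(1)] by auto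
  have cQ: "continuous_on UNIV (\<lambda>t. Q t (x t))"
    by (intro Q.cont_comp x)
  {
    assume "solves \<epsilon> x y"
    then have D: "\<And>t. (x has_real_derivative P t (y t)) (at t)"
      "\<And>t. (y has_real_derivative \<epsilon> * Q t (x t)) (at t)"
      by (auto simp: solves_def)
    have Y: "y t = y 0 + osc L (\<lambda>t. \<epsilon> * Q t (x t)) t" for t
      using osc_derivative[OF fQ(1) D(2) y(2)] by simp
    have ys: "ystep \<epsilon> x y = y"
      using P.correction_eq[OF Y mean_derivative[OF fP D(1) x(1)]] by (auto simp: ystep_def)
    have X: "x t = x 0 + osc L (\<lambda>t. P t (y t)) t" for t
      using osc_derivative[OF fP D(1) x(1)] by simp
    \<comment> \<open>Periodicity of y only gives a vanishing mean of \<epsilon> Q; \<epsilon> is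
      divided out here.\<close>
    have "mean L (\<lambda>t. Q t (x t)) = 0"
      using mean_derivative[OF fQ(1) D(2) y(2)] mean_cmult[OF cQ, of L \<epsilon>] \<open>\<epsilon> \<noteq> 0\<close> by simp
    from Q.correction_eq[OF X this] show "xstep \<epsilon> x y = x \<and> ystep \<epsilon> x y = y"
      by (auto simp: xstep_def ys)
  }
  {
    assume fixed: "xstep \<epsilon> x y = x \<and> ystep \<epsilon> x y = y"
    have "P.correction (y 0) (osc L (\<lambda>t. \<epsilon> * Q t (x t))) t = y t" for t
      using fixed by (simp add: ystep_def fun_eq_iff)
    note mP = P.correction_fixed(1)[of y, OF this osc_0]
      and Y = P.correction_fixed(2)[of y, OF this osc_0]
    have ys: "ystep \<epsilon> x y = y" using fixed by simp
    have "xstep \<epsilon> x y t = x t" for t using fixed by simp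
    then have "Q.correction (x 0) (osc L (\<lambda>t. P t (y t))) t = x t" for t
      unfolding xstep_def ys .
    note mQ = Q.correction_fixed(1)[of x, OF this osc_0]
      and X = Q.correction_fixed(2)[of x, OF this osc_0]
    have Dx: "((\<lambda>t. x 0 + osc L (\<lambda>t. P t (y t)) t) has_real_derivative P t (y t)) (at t)" for t
      using osc_has_derivative[OF fP, of L t] mP by (auto intro!: derivative_eq_intros)
    have Dy: "((\<lambda>t. y 0 + osc L (\<lambda>t. \<epsilon> * Q t (x t)) t) has_real_derivative \<epsilon> * Q t (x t)) (at t)" for t
      using osc_has_derivative[OF fQ(1), of L t] mQ mean_cmult[OF cQ, of L \<epsilon>]
      by (auto intro!: derivative_eq_intros)
    have e: "(\<lambda>t. x 0 + osc L (\<lambda>t. P t (y t)) t) = x" "(\<lambda>t. y 0 + osc L (\<lambda>t. \<epsilon> * Q t (x t)) t) = y"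
      by (rule ext, rule sym, rule X, rule ext, rule sym, rule Y)
    show "solves \<epsilon> x y"
      using Dx[unfolded e(1)] Dy[unfolded e(2)] unfolding solves_def by blast
  }
qed

text \<open>Continuity is part of the type, and evaluation at a point is continuous in the sup
  metric, so periodicity and the bound are intersections of closed conditions.\<close>

lemma closed_admissible: "closed {f :: real \<Rightarrow>\<^sub>C real. admissible \<rho> f}"
proof -
  have "continuous_on UNIV (\<lambda>f :: real \<Rightarrow>\<^sub>C real. f t)" for t
    unfolding continuous_on_iff using dist_bounded le_less_trans by metis
  then have "closed ((\<Inter>t. {f :: real \<Rightarrow>\<^sub>C real. f (t + L) = f t}) \<inter>
      (\<Inter>t. {f :: real \<Rightarrow>\<^sub>C real. \<bar>f t\<bar> \<le> \<rho>}))"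
    by (intro closed_Int closed_INT ballI closed_Collect_eq closed_Collect_le continuous_intros)
  also have "\<dots> = {f :: real \<Rightarrow>\<^sub>C real. admissible \<rho> f}"
    by (auto simp: admissible_def periodic_def)
  finally show ?thesis .
qed

text \<open>The two lower bounds on \<open>R\<close> make the steps map the ball of radius
  \<open>R * \<bar>\<epsilon>\<bar>\<close> into itself.\<close>

lemma ex1_solution:
  assumes "\<epsilon> \<noteq> 0" "A * (Bx + 1) \<le> R" "By \<le> R"
  shows "\<exists>!u. admissible \<rho> (fst u) \<and> admissible \<rho> (snd u) \<and> solves \<epsilon> (fst u) (snd u)"
proof -
  define S where "S = {f :: real \<Rightarrow>\<^sub>C real. admissible \<rho> f} \<times> {f :: real \<Rightarrow>\<^sub>C real. admissible \<rho> f}"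
  define \<Phi> where "\<Phi> = (\<lambda>u :: (real \<Rightarrow>\<^sub>C real) \<times> (real \<Rightarrow>\<^sub>C real).
    (Bcontfun (xstep \<epsilon> (fst u) (snd u)), Bcontfun (ystep \<epsilon> (fst u) (snd u))))"
  have Bcontfun: "apply_bcontfun (Bcontfun f) = f" if "admissible \<rho>' f" for f \<rho>'
  proof -
    have "bounded (range f)"
      using admissibleD(3)[OF that] by (auto simp: bounded_iff)
    then have "f \<in> bcontfun"
      using admissibleD(1)[OF that] by (simp add: bcontfun_def)
    then show ?thesis by (rule Bcontfun_inverse)
  qed
  have step: "admissible \<rho> (xstep \<epsilon> x y)" "admissible \<rho> (ystep \<epsilon> x y)"
    if "admissible \<rho> x" "admissible \<rho> y" for x y
  proof -
    have "A * (Bx + 1) * \<bar>\<epsilon>\<bar> \<le> \<rho>" "By * \<bar>\<epsilon>\<bar> \<le> \<rho>"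
      using assms(2,3) by (auto intro: mult_right_mono)
    then show "admissible \<rho> (xstep \<epsilon> x y)" "admissible \<rho> (ystep \<epsilon> x y)"
      using admissibleD[OF xstep_admissible[OF that]] admissible_le[OF xstep_admissible[OF that]]
        admissibleD[OF ystep_admissible[OF that]] admissible_le[OF ystep_admissible[OF that]]
      unfolding admissible_def by blast+
  qed
  have \<Phi>: "apply_bcontfun (fst (\<Phi> u)) = xstep \<epsilon> (fst u) (snd u)"
    "apply_bcontfun (snd (\<Phi> u)) = ystep \<epsilon> (fst u) (snd u)" if "u \<in> S" for u
    using that by (auto simp: S_def \<Phi>_def intro!: Bcontfun[of \<rho>] step)
  have "\<exists>!u\<in>S. \<Phi> u = u"
  proof (rule Banach_fix)
    show "complete S"
      unfolding S_def complete_eq_closed by (intro closed_Times closed_admissible)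
    have "admissible \<rho> (apply_bcontfun (const_bcontfun 0))"
      using R_nonneg by (simp add: admissible_def periodic_def)
    then have "(const_bcontfun 0, const_bcontfun 0) \<in> S" unfolding S_def by blast
    then show "S \<noteq> {}" by blast
    have "\<Phi> u \<in> S" if "u \<in> S" for u
      using \<Phi>[OF that] step[of "fst u" "snd u"] that by (simp add: S_def mem_Times_iff)
    then show "\<Phi> ` S \<subseteq> S" by blast
    show "dist (\<Phi> u) (\<Phi> v) \<le> 1 / 2 * dist u v" if "u \<in> S" "v \<in> S" for u v
    proof -
      have d: "\<bar>apply_bcontfun (fst u) t - apply_bcontfun (fst v) t\<bar> \<le> dist u v"
        "\<bar>apply_bcontfun (snd u) t - apply_bcontfun (snd v) t\<bar> \<le> dist u v" for t
        using order_trans[OF dist_bounded dist_fst_le, of u t v]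
          order_trans[OF dist_bounded dist_snd_le, of u t v] by (auto simp: dist_real_def)
      have adm: "admissible \<rho> (fst u)" "admissible \<rho> (snd u)" "admissible \<rho> (fst v)" "admissible \<rho> (snd v)"
        using that by (auto simp: S_def)
      note c = step_contraction[OF adm d]
      have "dist (fst (\<Phi> u)) (fst (\<Phi> v)) \<le> dist u v / 4" "dist (snd (\<Phi> u)) (snd (\<Phi> v)) \<le> dist u v / 4"
        by (rule dist_bound, use c in \<open>simp add: \<Phi>[OF that(1)] \<Phi>[OF that(2)] dist_real_def\<close>)+
      \<comment> \<open>The product metric is Euclidean and at most the sum of the component
        distances, so two factors 1/4 give 1/2.\<close>
      moreover have "dist (\<Phi> u) (\<Phi> v) \<le> dist (fst (\<Phi> u)) (fst (\<Phi> v)) + dist (snd (\<Phi> u)) (snd (\<Phi> v))"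
        unfolding dist_prod_def by (intro sqrt_sum_squares_le_sum) auto
      ultimately show ?thesis by linarith
    qed
  qed auto
  then obtain u where u: "u \<in> S" "\<Phi> u = u" and uniq: "\<And>v. v \<in> S \<Longrightarrow> \<Phi> v = v \<Longrightarrow> v = u"
    by blast
  have iff: "solves \<epsilon> (fst v) (snd v) \<longleftrightarrow> \<Phi> v = v" if "v \<in> S" for v
  proof -
    have "\<Phi> v = v \<longleftrightarrow> apply_bcontfun (fst (\<Phi> v)) = fst v \<and> apply_bcontfun (snd (\<Phi> v)) = snd v"
      by (metis apply_bcontfun_inject prod_eq_iff)
    then show ?thesis
      using solves_iff_fixed[OF assms(1)] that by (simp add: \<Phi> S_def mem_Times_iff)
  qed
  show ?thesis
  proof (rule ex1I[of _ "(apply_bcontfun (fst u), apply_bcontfun (snd u))"])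
    show "admissible \<rho> (fst (apply_bcontfun (fst u), apply_bcontfun (snd u))) \<and>
      admissible \<rho> (snd (apply_bcontfun (fst u), apply_bcontfun (snd u))) \<and>
      solves \<epsilon> (fst (apply_bcontfun (fst u), apply_bcontfun (snd u)))
        (snd (apply_bcontfun (fst u), apply_bcontfun (snd u)))"
      using u iff by (auto simp: S_def mem_Times_iff)
    fix w assume w: "admissible \<rho> (fst w) \<and> admissible \<rho> (snd w) \<and> solves \<epsilon> (fst w) (snd w)"
    define v where "v = (Bcontfun (fst w), Bcontfun (snd w))"
    have v: "apply_bcontfun (fst v) = fst w" "apply_bcontfun (snd v) = snd w"
      using Bcontfun w by (auto simp: v_def)
    then have "v \<in> S" using w by (simp add: S_def mem_Times_iff)
    then have "v = u" using uniq[of v] iff[of v] w v by simp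
    then show "w = (apply_bcontfun (fst u), apply_bcontfun (snd u))"
      using v by (simp add: prod_eq_iff)
  qed
qed

end

section \<open>Choice of the radius and of the smallness threshold\<close>

context coupled_nonlinearities
begin

theorem ex1_periodic_solution:
  obtains R0 where "0 < R0"
    "\<And>R. R0 \<le> R \<Longrightarrow> \<exists>\<delta>>0. \<forall>\<epsilon>. \<epsilon> \<noteq> 0 \<and> \<bar>\<epsilon>\<bar> < \<delta> \<longrightarrow>
      (\<exists>!u. admissible (R * \<bar>\<epsilon>\<bar>) (fst u) \<and> admissible (R * \<bar>\<epsilon>\<bar>) (snd u) \<and> solves \<epsilon> (fst u) (snd u))"
proof
  let ?R0 = "A * (Bx + 1) + By"
  show "0 < ?R0"
    using A_ge_1 Bx_pos By_pos by (intro add_pos_pos mult_pos_pos) auto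
  fix R assume R: "?R0 \<le> R"
  have pos: "0 < A" "0 < L" "0 < M" "0 < A * (Bx + 1)"
    using A_ge_1 Bx_pos P.L_pos P.M_pos by auto
  then have "0 \<le> R" "A * (Bx + 1) \<le> R" "By \<le> R"
    using R By_pos by linarith+
  define K1 where "K1 = R + 6 * L * M + Bx"
  define K2 where "K2 = (R + 6 * L * M + Bx) * R"
  define K4 where "K4 = A * (10 * L * M + R)"
  define K5 where "K5 = A * (4 * L * M * (A * (10 * L * M + R)) + R + Bx)"
  have K: "0 \<le> K1" "0 \<le> K2" "0 \<le> K4" "0 \<le> K5"
    unfolding K1_def K2_def K4_def K5_def using pos \<open>0 \<le> R\<close> Bx_pos
    by (intro add_nonneg_nonneg mult_nonneg_nonneg; simp)+
  \<comment> \<open>Every coefficient is at most the denominator, so this one threshold yields all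
    five conditions of \<open>small_coupling\<close>; 1/4 also serves where the bound is 1.\<close>
  define \<delta> where "\<delta> = min r (1 / 4) / (K1 + K2 + By + K4 + K5)"
  have sum_pos: "0 < K1 + K2 + By + K4 + K5" using K By_pos by linarith
  show "\<exists>\<delta>>0. \<forall>\<epsilon>. \<epsilon> \<noteq> 0 \<and> \<bar>\<epsilon>\<bar> < \<delta> \<longrightarrow>
      (\<exists>!u. admissible (R * \<bar>\<epsilon>\<bar>) (fst u) \<and> admissible (R * \<bar>\<epsilon>\<bar>) (snd u) \<and> solves \<epsilon> (fst u) (snd u))"
  proof (intro exI[of _ \<delta>] conjI allI impI)
    show "0 < \<delta>" unfolding \<delta>_def using P.r_pos sum_pos by simp
    fix \<epsilon> :: real assume \<epsilon>: "\<epsilon> \<noteq> 0 \<and> \<bar>\<epsilon>\<bar> < \<delta>"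
    have *: "K * \<bar>\<epsilon>\<bar> \<le> min r (1 / 4)" if "0 \<le> K" "K \<le> K1 + K2 + By + K4 + K5" for K
    proof -
      have "K * \<bar>\<epsilon>\<bar> \<le> (K1 + K2 + By + K4 + K5) * \<delta>"
        using that \<epsilon> sum_pos by (intro mult_mono) auto
      also have "\<dots> = min r (1 / 4)" using sum_pos by (simp add: \<delta>_def)
      finally show ?thesis .
    qed
    have b: "K1 * \<bar>\<epsilon>\<bar> \<le> r" "K2 * \<bar>\<epsilon>\<bar> \<le> 1" "By * \<bar>\<epsilon>\<bar> \<le> r" "K4 * \<bar>\<epsilon>\<bar> \<le> 1 / 4" "K5 * \<bar>\<epsilon>\<bar> \<le> 1 / 4"
      using *[of K1] *[of K2] *[of By] *[of K4] *[of K5] K By_pos by auto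
    have "small_coupling L r M P p Q q R \<epsilon>"
    proof
      show "0 \<le> R" by fact
      show "(R + 6 * L * M + Bx) * \<bar>\<epsilon>\<bar> \<le> r" "(R + 6 * L * M + Bx) * R * \<bar>\<epsilon>\<bar> \<le> 1"
        "By * \<bar>\<epsilon>\<bar> \<le> r" "A * (10 * L * M + R) * \<bar>\<epsilon>\<bar> \<le> 1 / 4"
        "A * (4 * L * M * (A * (10 * L * M + R)) + R + Bx) * \<bar>\<epsilon>\<bar> \<le> 1 / 4"
        by (rule b[unfolded K1_def K2_def K4_def K5_def])+
    qed
    then show "\<exists>!u. admissible (R * \<bar>\<epsilon>\<bar>) (fst u) \<and> admissible (R * \<bar>\<epsilon>\<bar>) (snd u) \<and> solves \<epsilon> (fst u) (snd u)"
      using \<epsilon> \<open>A * (Bx + 1) \<le> R\<close> \<open>By \<le> R\<close> by (intro small_coupling.ex1_solution) auto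
  qed
qed

end

section \<open>Inverse functions and elliptic functions\<close>

text \<open>Strict monotonicity gives injectivity; the shift relation makes \<open>f\<close>
  unbounded in both directions, hence surjective, and it passes to the inverse. The lemma serves for
  the amplitude and for both passages between time and angle.\<close>

lemma increasing_inverse:
  fixes f f' :: "real \<Rightarrow> real"
  assumes D: "\<And>x. (f has_real_derivative f' x) (at x)" and pos: "\<And>x. 0 < f' x"
    and shift: "\<And>x. f (x + L) = f x + T" and T: "0 < T"
  obtains g where "\<And>x. g (f x) = x" "\<And>y. f (g y) = y"
    "\<And>y. (g has_real_derivative 1 / f' (g y)) (at y)" "\<And>y. g (y + T) = g y + L"
proof
  let ?g = "inv f"
  have mono: "f x < f y" if "x < y" for x y
    using DERIV_pos_imp_increasing[OF that, of f] D pos by blast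
  have "inj f"
    by (rule linorder_injI) (use mono in force)
  have cont: "isCont f x" for x
    using D DERIV_isCont by blast
  have "L \<noteq> 0"
    using shift[of 0] T by auto
  \<comment> \<open>Subtracting a linear function of slope \<open>T / L\<close> leaves a periodic
    function, which gives the values of \<open>f\<close> at all multiples of
    \<open>L\<close>.\<close>
  then have "periodic L (\<lambda>x. f x - T / L * x)"
    using shift by (simp add: periodic_def field_simps)
  with \<open>L \<noteq> 0\<close> have multiple: "f (of_int n * L) = f 0 + of_int n * T" for n
    using periodic_int[of L "\<lambda>x. f x - T / L * x" 0 n] by (simp add: algebra_simps)
  have "\<exists>x. f x = y" for y
  proof -
    define n where "n = \<lceil>(\<bar>y\<bar> + \<bar>f 0\<bar>) / T\<rceil>"
    have "(\<bar>y\<bar> + \<bar>f 0\<bar>) / T \<le> of_int n"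
      unfolding n_def by (rule le_of_int_ceiling)
    then have n: "\<bar>y\<bar> + \<bar>f 0\<bar> \<le> of_int n * T"
      using T by (simp only: pos_divide_le_eq)
    have "f (of_int (- n) * L) \<le> y" "y \<le> f (of_int n * L)"
      unfolding multiple using n by auto
    moreover from this have "of_int (- n) * L \<le> of_int n * L"
      using mono[of "of_int n * L" "of_int (- n) * L"] by linarith
    ultimately show ?thesis
      using IVT[of f "of_int (- n) * L" y "of_int n * L"] cont by blast
  qed
  then have "surj f" by (metis surjI)
  show gf: "?g (f x) = x" for x by (rule inv_f_f[OF \<open>inj f\<close>])
  show fg: "f (?g y) = y" for y by (rule surj_f_inv_f[OF \<open>surj f\<close>])
  have "isCont ?g y" for y
    using isCont_inverse_function[of 1 "?g y" ?g f] gf cont fg[of y] by simp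
  then show "(?g has_real_derivative 1 / f' (?g y)) (at y)" for y
    using DERIV_inverse_function[of f "f' (?g y)" ?g y "y - 1" "y + 1"] D pos[of "?g y"] fg
    by (simp add: inverse_eq_divide)
  show "?g (y + T) = ?g y + L" for y
    using shift[of "?g y"] gf fg by metis
qed

section \<open>Elliptic integrals, the amplitude and dn\<close>

locale modulus =
  fixes k :: real
  assumes k_pos: "0 < k" and k_less_1: "k < 1"
begin

text \<open>dn as a function of the amplitude:
  \<open>jacobi_dn u k = w (jacobi_am u k)\<close>.\<close>

definition w :: "real \<Rightarrow> real" where "w \<phi> = sqrt (1 - k\<^sup>2 * (sin \<phi>)\<^sup>2)"

lemma w_pos: "0 < w \<phi>"
proof -
  have "k\<^sup>2 * (sin \<phi>)\<^sup>2 \<le> k\<^sup>2 * 1"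
    by (intro mult_left_mono) (auto simp: abs_square_le_1)
  also have "\<dots> < 1" using k_pos k_less_1 by (simp add: power_less_one_iff)
  finally show ?thesis by (simp add: w_def)
qed

lemma continuous_w: "continuous_on S w"
  unfolding w_def[abs_def] by (intro continuous_intros)

lemma ellF_has_derivative: "((\<lambda>\<phi>. incomplete_ellF \<phi> k) has_real_derivative 1 / w \<phi>) (at \<phi>)"
proof -
  have "continuous_on UNIV (\<lambda>\<phi>. 1 / w \<phi>)"
    using w_pos by (intro continuous_intros continuous_w) (auto simp: less_imp_neq[symmetric])
  from prim_has_derivative[OF this] show ?thesis
    unfolding incomplete_ellF_def prim_def[abs_def] w_def .
qed

lemma ellF_0: "incomplete_ellF 0 k = 0"
  by (simp add: incomplete_ellF_def zero_ereal_def)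

lemma w_add_pi: "w (\<phi> + pi) = w \<phi>" and w_minus: "w (- \<phi>) = w \<phi>"
  by (simp_all add: w_def)

lemma ellF_minus: "incomplete_ellF (- \<phi>) k = - incomplete_ellF \<phi> k"
proof -
  have "((\<lambda>\<phi>. incomplete_ellF (- \<phi>) k + incomplete_ellF \<phi> k) has_real_derivative 0) (at \<phi>)" for \<phi>
    using DERIV_chain2[OF ellF_has_derivative DERIV_minus[OF DERIV_ident], of \<phi>]
      ellF_has_derivative[of \<phi>]
    by (auto intro!: derivative_eq_intros simp: w_minus)
  then have "incomplete_ellF (- \<phi>) k + incomplete_ellF \<phi> k = incomplete_ellF (- 0) k + incomplete_ellF 0 k"
    using DERIV_isconst_all by blast
  then show ?thesis by (simp add: ellF_0)
qed

text \<open>The integrand has period pi, so the difference of the two integrals is constant in the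
  angle; at \<open>- (pi / 2)\<close> oddness evaluates it as
  \<open>2 * complete_ellK k\<close>.\<close>

lemma ellF_add_pi: "incomplete_ellF (\<phi> + pi) k = incomplete_ellF \<phi> k + 2 * complete_ellK k"
proof -
  have "((\<lambda>\<phi>. incomplete_ellF (\<phi> + pi) k - incomplete_ellF \<phi> k) has_real_derivative 0) (at \<phi>)" for \<phi>
    using ellF_has_derivative[of "\<phi> + pi"] ellF_has_derivative[of \<phi>]
      DERIV_shift[of "\<lambda>\<phi>. incomplete_ellF \<phi> k" "1 / w (\<phi> + pi)" \<phi> pi]
    by (auto intro!: derivative_eq_intros simp: w_add_pi)
  then have "incomplete_ellF (\<phi> + pi) k - incomplete_ellF \<phi> k =
      incomplete_ellF (- (pi / 2) + pi) k - incomplete_ellF (- (pi / 2)) k"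
    using DERIV_isconst_all by blast
  then show ?thesis by (simp add: ellF_minus complete_ellK_def)
qed

lemma ellK_pos: "0 < complete_ellK k"
proof -
  have "incomplete_ellF 0 k < incomplete_ellF (pi / 2) k"
    using DERIV_pos_imp_increasing[of 0 "pi / 2" "\<lambda>\<phi>. incomplete_ellF \<phi> k"]
      ellF_has_derivative w_pos zero_less_divide_1_iff pi_half_gt_zero by blast
  then show ?thesis by (simp add: ellF_0 complete_ellK_def)
qed

lemma am_ellF [simp]: "jacobi_am (incomplete_ellF \<phi> k) k = \<phi>"
  and ellF_am [simp]: "incomplete_ellF (jacobi_am u k) k = u"
  and am_has_derivative: "((\<lambda>u. jacobi_am u k) has_real_derivative jacobi_dn u k) (at u)"
proof -
  obtain g where g: "\<And>\<phi>. g (incomplete_ellF \<phi> k) = \<phi>" "\<And>u. incomplete_ellF (g u) k = u"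
    "\<And>u. (g has_real_derivative 1 / (1 / w (g u))) (at u)"
    using increasing_inverse[OF ellF_has_derivative _ ellF_add_pi] w_pos ellK_pos
    by (metis zero_less_divide_1_iff zero_less_mult_iff zero_less_numeral)
  have am: "jacobi_am u k = g u" for u
    unfolding jacobi_am_def using g by (intro the_equality) auto
  show "jacobi_am (incomplete_ellF \<phi> k) k = \<phi>" "incomplete_ellF (jacobi_am u k) k = u"
    "((\<lambda>u. jacobi_am u k) has_real_derivative jacobi_dn u k) (at u)" for \<phi> u
    using g by (auto simp: am jacobi_dn_def w_def)
qed

lemma continuous_dn: "continuous_on S (\<lambda>u. jacobi_dn u k)"
proof -
  have "continuous_on S (\<lambda>u. jacobi_am u k)"
    using am_has_derivative DERIV_isCont continuous_at_imp_continuous_on by blast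
  then show ?thesis unfolding jacobi_dn_def by (intro continuous_intros)
qed

end

section \<open>The pendulum with the angle as independent variable\<close>

text \<open>Subtracting the linear part leaves a function whose derivative is at most
  \<open>B * e\<close> on [-e, e]; the mean value inequality gives the rest.\<close>

lemma linearization_bound:
  fixes N :: "real \<Rightarrow> real"
  assumes "\<And>x. \<bar>x\<bar> \<le> r \<Longrightarrow> (N has_real_derivative N' x) (at x)"
    and "\<And>x. \<bar>x\<bar> \<le> r \<Longrightarrow> \<bar>N' x - n\<bar> \<le> B * \<bar>x\<bar>"
    and "\<bar>x\<bar> \<le> e" "\<bar>y\<bar> \<le> e" "e \<le> r" "0 \<le> B"
  shows "\<bar>N x - N y - n * (x - y)\<bar> \<le> B * e * \<bar>x - y\<bar>"
proof -
  have "norm ((N x - n * x) - (N y - n * y)) \<le> B * e * norm (x - y)"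
  proof (rule field_differentiable_bound)
    show "convex {-e..e}" by simp
    fix z assume z: "z \<in> {-e..e}"
    then have "\<bar>z\<bar> \<le> r" "\<bar>z\<bar> \<le> e" using assms(5) by auto
    from DERIV_diff[OF assms(1)[OF this(1)] DERIV_cmult[OF DERIV_ident, of n]]
    show "((\<lambda>x. N x - n * x) has_field_derivative N' z - n) (at z within {-e..e})"
      by (simp add: has_field_derivative_at_within)
    have "\<bar>N' z - n\<bar> \<le> B * \<bar>z\<bar>" by (rule assms(2)[OF \<open>\<bar>z\<bar> \<le> r\<close>])
    also have "\<dots> \<le> B * e" by (rule mult_left_mono[OF \<open>\<bar>z\<bar> \<le> e\<close> assms(6)])
    finally show "norm (N' z - n) \<le> B * e" by simp
  qed (use assms(3,4) in auto)
  then show ?thesis by (simp add: algebra_simps)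
qed

lemma lipschitz_from_derivative:
  fixes f f' :: "real \<Rightarrow> real"
  assumes "\<And>x. \<bar>x\<bar> \<le> r \<Longrightarrow> (f has_real_derivative f' x) (at x)"
    and "\<And>x. \<bar>x\<bar> \<le> r \<Longrightarrow> \<bar>f' x\<bar> \<le> B" and "\<bar>x\<bar> \<le> r" "\<bar>y\<bar> \<le> r"
  shows "\<bar>f x - f y\<bar> \<le> B * \<bar>x - y\<bar>"
proof -
  have "norm (f x - f y) \<le> B * norm (x - y)"
  proof (rule field_differentiable_bound)
    show "convex {-r..r}" by simp
    fix z assume "z \<in> {-r..r}"
    then have "\<bar>z\<bar> \<le> r" by auto
    from assms(1,2)[OF this] show "(f has_field_derivative f' z) (at z within {-r..r})" "norm (f' z) \<le> B"
      by (simp_all add: has_field_derivative_at_within)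
  qed (use assms(3,4) in auto)
  then show ?thesis by simp
qed

lemma mean_neg:
  assumes "0 < L" "continuous_on UNIV f" "\<And>t. f t < 0"
  shows "mean L f < 0"
proof -
  obtain z where "prim f L - prim f 0 = (L - 0) * f z"
    using MVT2[OF assms(1), of "prim f" f] prim_has_derivative[OF assms(2)] by blast
  then show ?thesis
    using assms(1) assms(3)[of z] by (simp add: mean_def)
qed

lemma periodic_derivative:
  fixes f :: "real \<Rightarrow> real"
  assumes "periodic L f" "\<And>t. f differentiable (at t)"
  shows "periodic L (deriv f)"
proof -
  have D: "(f has_real_derivative deriv f t) (at t)" for t
    using assms(2) by (simp add: DERIV_deriv_iff_real_differentiable)
  have "((\<lambda>t. f (t + L)) has_real_derivative deriv f (t + L)) (at t)" for t
    using D[of "t + L"] by (simp add: DERIV_shift)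
  moreover have "(\<lambda>t. f (t + L)) = f"
    using assms(1) by (auto simp: periodic_def)
  ultimately show ?thesis
    using D DERIV_unique unfolding periodic_def by metis
qed

locale forced_pendulum = modulus +
  fixes c d \<alpha>\<^sub>0 :: real and \<gamma> :: "real \<Rightarrow> real" and p q :: nat
  assumes c_pos: "0 < c" and \<gamma>_periodic: "periodic 1 \<gamma>" and \<gamma>_C2: "C2_real \<gamma>"
    and p_pos: "0 < p" and q_pos: "0 < q"
    and resonance: "complete_ellK k * k = c * real p / real q"
    and d_less: "d < 8 * c\<^sup>2 / k\<^sup>2 * (1 - k\<^sup>2)"
    and melnikov: "integral {0..real p} (\<lambda>t. \<gamma> (t + \<alpha>\<^sub>0) * jacobi_dn (2 * c * t / k) k) = 0"
    and melnikov': "integral {0..real p} (\<lambda>t. deriv \<gamma> (t + \<alpha>\<^sub>0) * jacobi_dn (2 * c * t / k) k) \<noteq> 0"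
begin

text \<open>The least squared value of \<open>speed\<close> on the unperturbed orbit, attained where
  cos vanishes. The hypothesis on \<open>d\<close> says that \<open>d / 2 < m\<close>.\<close>

definition m :: real where "m = 4 * c\<^sup>2 / k\<^sup>2 * (1 - k\<^sup>2)"

definition z0 :: real where "z0 = sqrt (m - d / 2)"

text \<open>For \<open>\<bar>z - z0\<bar> \<le> r\<close> the square of z is at least z0^2 - 2 r z0,
  hence at least z0^2 - m/2. The squared speed thus keeps half of its minimum \<open>m\<close>, and
  \<open>s0\<close> is a lower bound for the speed.\<close>

definition r :: real where "r = min 1 (m / (4 * z0))"

definition s0 :: real where "s0 = sqrt (m / 2)"

definition L :: real where "L = pi * real q"

text \<open>With \<open>\<phi> = (\<psi> - \<pi>) / 2\<close>, the level set equation for \<open>\<phi>' > 0\<close> reads \<open>\<phi>' = speed \<phi> z\<close>.\<close>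

definition speed :: "real \<Rightarrow> real \<Rightarrow> real" where
  "speed \<phi> z = sqrt (d / 2 + z\<^sup>2 + 4 * c\<^sup>2 * (cos \<phi>)\<^sup>2)"

text \<open>The time at which the unperturbed orbit, started with angle 0 at time 0, reaches the
  angle \<phi>.\<close>

definition t0 :: "real \<Rightarrow> real" where "t0 \<phi> = k / (2 * c) * incomplete_ellF \<phi> k"

text \<open>\<open>delay\<close> and \<open>force\<close> are the P and Q of the abstract problem,
  and the primed versions are their derivatives at deviation 0.\<close>

definition delay :: "real \<Rightarrow> real \<Rightarrow> real" where
  "delay \<phi> y = 1 / speed \<phi> (z0 + y) - 1 / speed \<phi> z0"

definition delay' :: "real \<Rightarrow> real" where "delay' \<phi> = - z0 / speed \<phi> z0 ^ 3"

text \<open>The factor 2 arises because \<psi> moves at twice the rate of the angle: dividing z' by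
  the angular speed leaves 2 \<epsilon> \<gamma>.\<close>

definition force :: "real \<Rightarrow> real \<Rightarrow> real" where "force \<phi> x = 2 * \<gamma> (t0 \<phi> + \<alpha>\<^sub>0 + x)"

definition force' :: "real \<Rightarrow> real" where "force' \<phi> = 2 * deriv \<gamma> (t0 \<phi> + \<alpha>\<^sub>0)"

section \<open>Bounds on the speed, and the unperturbed motion\<close>

lemma m_pos: "0 < m"
  using c_pos k_pos k_less_1 by (simp add: m_def power_less_one_iff)

lemma z0_pos: "0 < z0" and z0_sq: "z0\<^sup>2 = m - d / 2"
  using d_less by (auto simp: z0_def m_def)

lemma r_pos: "0 < r" and r_le_1: "r \<le> 1"
  using m_pos z0_pos by (auto simp: r_def)

lemma L_pos: "0 < L" and s0_pos: "0 < s0"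
  using q_pos m_pos by (auto simp: L_def s0_def)

lemma radicand:
  assumes "\<bar>z - z0\<bar> \<le> r"
  shows "m / 2 \<le> d / 2 + z\<^sup>2"
proof -
  have "r * z0 \<le> m / (4 * z0) * z0"
    using z0_pos by (intro mult_right_mono) (auto simp: r_def)
  then have "r * z0 \<le> m / 4" using z0_pos by simp
  moreover have "\<bar>z - z0\<bar> * z0 \<le> r * z0"
    using assms z0_pos by (intro mult_right_mono) auto
  moreover have "(- \<bar>z - z0\<bar>) * z0 \<le> (z - z0) * z0"
    using z0_pos by (intro mult_right_mono) auto
  moreover have "z\<^sup>2 = z0\<^sup>2 + 2 * ((z - z0) * z0) + (z - z0)\<^sup>2"
    by (simp add: power2_eq_square algebra_simps)
  ultimately show ?thesis using z0_sq zero_le_power2[of "z - z0"] by linarith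
qed

lemma speed_ge:
  assumes "\<bar>z - z0\<bar> \<le> r"
  shows "s0 \<le> speed \<phi> z"
  unfolding s0_def speed_def using radicand[OF assms] by (intro real_sqrt_le_mono) (simp add: add_increasing2)

lemma speed_pos: "\<bar>z - z0\<bar> \<le> r \<Longrightarrow> 0 < speed \<phi> z"
  using speed_ge s0_pos less_le_trans by blast

lemma speed_sq:
  assumes "\<bar>z - z0\<bar> \<le> r"
  shows "(speed \<phi> z)\<^sup>2 = d / 2 + z\<^sup>2 + 4 * c\<^sup>2 * (cos \<phi>)\<^sup>2"
  unfolding speed_def using radicand[OF assms] m_pos by (intro real_sqrt_pow2) (simp add: add_nonneg_nonneg)

text \<open>At \<open>z0\<close> the constant \<open>d\<close> cancels, and the radicand becomes a
  multiple of 1 - k^2 sin^2; so the unperturbed motion is a rescaled amplitude.\<close>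

lemma speed_z0: "speed \<phi> z0 = 2 * c / k * w \<phi>"
proof -
  have "d / 2 + z0\<^sup>2 + 4 * c\<^sup>2 * (cos \<phi>)\<^sup>2 = (2 * c / k)\<^sup>2 * (1 - k\<^sup>2 * (sin \<phi>)\<^sup>2)"
    unfolding z0_sq m_def cos_squared_eq using k_pos by (simp add: field_simps power2_eq_square)
  then show ?thesis
    unfolding speed_def w_def using c_pos k_pos by (simp add: real_sqrt_mult)
qed

lemma speed_add: "speed (\<phi> + pi * real n) z = speed \<phi> z"
proof -
  have "(cos (\<phi> + pi * real n))\<^sup>2 = (cos \<phi>)\<^sup>2"
    by (simp add: cos_add sin_npi2 cos_npi2 power_mult_distrib flip: power_mult)
  then show ?thesis by (simp add: speed_def)
qed

lemma speed_has_derivative_z: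
  assumes "\<bar>z - z0\<bar> \<le> r"
  shows "(speed \<phi> has_real_derivative z / speed \<phi> z) (at z)"
proof -
  have "0 < d / 2 + z\<^sup>2 + 4 * c\<^sup>2 * (cos \<phi>)\<^sup>2"
    using radicand[OF assms] m_pos by (simp add: add_pos_nonneg)
  then show ?thesis
    unfolding speed_def[abs_def] by (auto intro!: derivative_eq_intros simp: field_simps)
qed

lemma t0_has_derivative: "(t0 has_real_derivative 1 / speed \<phi> z0) (at \<phi>)"
  unfolding t0_def[abs_def] speed_z0
  by (rule DERIV_cong, rule DERIV_cmult, rule ellF_has_derivative) (use c_pos k_pos in simp)

lemma continuous_t0: "continuous_on S t0"
  using t0_has_derivative DERIV_isCont continuous_at_imp_continuous_on by blast

lemma ellF_add: "incomplete_ellF (\<phi> + pi * real n) k = incomplete_ellF \<phi> k + 2 * real n * complete_ellK k"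
proof (induction n)
  case (Suc n)
  have "\<phi> + pi * real (Suc n) = (\<phi> + pi * real n) + pi" by (simp add: algebra_simps)
  then show ?case unfolding \<open>\<phi> + pi * real (Suc n) = _\<close> ellF_add_pi Suc by (simp add: algebra_simps)
qed simp

lemma t0_add: "t0 (\<phi> + L) = t0 \<phi> + real p"
proof -
  have "k / (2 * c) * (2 * real q * complete_ellK k) = real p"
    using resonance c_pos q_pos by (simp add: field_simps)
  then show ?thesis
    unfolding t0_def L_def ellF_add by (simp add: algebra_simps)
qed

lemma t0_0: "t0 0 = 0"
  by (simp add: t0_def ellF_0)

lemma am_t0: "jacobi_am (2 * c * t0 \<phi> / k) k = \<phi>"
  using c_pos k_pos by (simp add: t0_def)

lemma t0_am: "t0 (jacobi_am (2 * c * t / k) k) = t"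
  using c_pos k_pos by (simp add: t0_def)

lemma \<gamma>_p: "\<gamma> (t + real p) = \<gamma> t"
  using periodic_int[OF \<gamma>_periodic, of t "int p"] by simp

lemma deriv_\<gamma>: "(\<gamma> has_real_derivative deriv \<gamma> t) (at t)"
    "(deriv \<gamma> has_real_derivative deriv (deriv \<gamma>) t) (at t)"
  and continuous_deriv2_\<gamma>: "continuous_on UNIV (deriv (deriv \<gamma>))"
  using \<gamma>_C2 by (auto simp: C2_real_def DERIV_deriv_iff_real_differentiable)

lemma continuous_\<gamma>: "continuous_on S \<gamma>" "continuous_on S (deriv \<gamma>)"
  using deriv_\<gamma> DERIV_isCont continuous_at_imp_continuous_on by blast+

text \<open>Substitution of the angle \<open>jacobi_am (2 * c * t / k) k\<close> for t, under which
  dn dt becomes k / (2 c) d\<phi>. It turns the Melnikov conditions into conditions on means over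
  the angle.\<close>

lemma dn_integral:
  assumes "continuous_on UNIV h"
  shows "integral {0..real p} (\<lambda>t. h (t + \<alpha>\<^sub>0) * jacobi_dn (2 * c * t / k) k)
    = k / (2 * c) * (L * mean L (\<lambda>\<phi>. h (t0 \<phi> + \<alpha>\<^sub>0)))"
proof -
  let ?h = "\<lambda>\<phi>. h (t0 \<phi> + \<alpha>\<^sub>0)"
  have h: "continuous_on UNIV ?h"
    by (intro continuous_on_compose2[OF assms] continuous_intros continuous_t0) auto
  have c: "continuous_on UNIV (\<lambda>t. h (t + \<alpha>\<^sub>0) * jacobi_dn (2 * c * t / k) k)"
    using k_pos
    by (intro continuous_intros continuous_on_compose2[OF assms] continuous_on_compose2[OF continuous_dn]) auto
  have "((\<lambda>t. k / (2 * c) * prim ?h (jacobi_am (2 * c * t / k) k)) has_real_derivative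
      h (t + \<alpha>\<^sub>0) * jacobi_dn (2 * c * t / k) k) (at t)" for t
  proof -
    have "((\<lambda>t. 2 * c * t / k) has_real_derivative 2 * c / k) (at t)"
      using k_pos by (auto intro!: derivative_eq_intros)
    from DERIV_chain2[OF am_has_derivative this]
    have "((\<lambda>t. jacobi_am (2 * c * t / k) k) has_real_derivative jacobi_dn (2 * c * t / k) k * (2 * c / k)) (at t)" .
    from DERIV_cmult[OF DERIV_chain2[OF prim_has_derivative[OF h] this], of "k / (2 * c)"]
    show ?thesis
      by (rule DERIV_cong) (use c_pos k_pos t0_am[of t] in simp)
  qed
  from prim_unique[OF c this, of "real p"]
  have "prim (\<lambda>t. h (t + \<alpha>\<^sub>0) * jacobi_dn (2 * c * t / k) k) (real p) =
      k / (2 * c) * prim ?h (jacobi_am (2 * c * t0 L / k) k) -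
      k / (2 * c) * prim ?h (jacobi_am (2 * c * t0 0 / k) k)"
    using t0_add[of 0] by (simp add: t0_0)
  then show ?thesis
    using integral_eq_prim[OF c, of "real p"] L_pos unfolding am_t0 by (simp add: mean_def)
qed

section \<open>Remainder bounds and mean conditions for the two nonlinearities\<close>

lemma delay_has_derivative:
  assumes "\<bar>y\<bar> \<le> r"
  shows "(delay \<phi> has_real_derivative - (z0 + y) / speed \<phi> (z0 + y) ^ 3) (at y)"
    "((\<lambda>y. - (z0 + y) / speed \<phi> (z0 + y) ^ 3) has_real_derivative
      3 * (z0 + y)\<^sup>2 / speed \<phi> (z0 + y) ^ 5 - 1 / speed \<phi> (z0 + y) ^ 3) (at y)"
proof -
  have y: "\<bar>(z0 + y) - z0\<bar> \<le> r" using assms by simp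
  note pos = speed_pos[OF y, of \<phi>]
  have D: "((\<lambda>y. speed \<phi> (z0 + y)) has_real_derivative (z0 + y) / speed \<phi> (z0 + y)) (at y)"
    using DERIV_shift[of "speed \<phi>" _ y z0] speed_has_derivative_z[OF y, of \<phi>]
    by (simp add: add.commute)
  let ?S = "speed \<phi> (z0 + y)"
  have S: "?S \<noteq> 0" "?S ^ 3 \<noteq> 0" using pos by simp_all
  show "(delay \<phi> has_real_derivative - (z0 + y) / ?S ^ 3) (at y)"
    unfolding delay_def[abs_def]
    by (rule DERIV_cong[OF DERIV_diff[OF DERIV_divide[OF DERIV_const D S(1)] DERIV_const]])
      (use S in \<open>simp add: field_simps eval_nat_numeral\<close>)
  show "((\<lambda>y. - (z0 + y) / speed \<phi> (z0 + y) ^ 3) has_real_derivative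
      3 * (z0 + y)\<^sup>2 / ?S ^ 5 - 1 / ?S ^ 3) (at y)"
    by (rule DERIV_cong[OF DERIV_divide[OF DERIV_minus[OF DERIV_add[OF DERIV_const DERIV_ident]]
            DERIV_power[OF D, of 3] S(2)]])
      (use S in \<open>simp add: field_simps eval_nat_numeral\<close>)
qed

text \<open>The constant bounds the second derivative of \<open>delay\<close>: the speed is at least
  \<open>s0\<close>, and \<open>z0 + y\<close> is at most \<open>z0 + 1\<close> in absolute value
  since \<open>r \<le> 1\<close>.\<close>

lemma delay_linear:
  assumes "\<bar>x\<bar> \<le> e" "\<bar>y\<bar> \<le> e" "e \<le> r"
  shows "\<bar>delay \<phi> x - delay \<phi> y - delay' \<phi> * (x - y)\<bar>
    \<le> (1 / s0 ^ 3 + 3 * (z0 + 1)\<^sup>2 / s0 ^ 5) * e * \<bar>x - y\<bar>"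
proof (rule linearization_bound[OF delay_has_derivative(1) _ assms])
  let ?B = "1 / s0 ^ 3 + 3 * (z0 + 1)\<^sup>2 / s0 ^ 5"
  show "0 \<le> ?B" using s0_pos by (intro add_nonneg_nonneg) auto
  fix x assume x: "\<bar>x\<bar> \<le> r"
  have "\<bar>- (z0 + x) / speed \<phi> (z0 + x) ^ 3 - - (z0 + 0) / speed \<phi> (z0 + 0) ^ 3\<bar> \<le> ?B * \<bar>x - 0\<bar>"
  proof (rule lipschitz_from_derivative[OF delay_has_derivative(2) _ x])
    show "\<bar>0 :: real\<bar> \<le> r" using r_pos by simp
    fix y assume y: "\<bar>y\<bar> \<le> r"
    have s: "s0 \<le> speed \<phi> (z0 + y)" using speed_ge[of "z0 + y" \<phi>] y by simp
    have "(z0 + y)\<^sup>2 \<le> (z0 + 1)\<^sup>2"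
      using y r_le_1 z0_pos by (intro abs_le_square_iff[THEN iffD1]) auto
    then have "3 * (z0 + y)\<^sup>2 / speed \<phi> (z0 + y) ^ 5 \<le> 3 * (z0 + 1)\<^sup>2 / s0 ^ 5"
      using s s0_pos by (intro frac_le power_mono) auto
    moreover have "1 / speed \<phi> (z0 + y) ^ 3 \<le> 1 / s0 ^ 3"
      using s s0_pos by (intro frac_le power_mono) auto
    moreover have "0 \<le> 3 * (z0 + y)\<^sup>2 / speed \<phi> (z0 + y) ^ 5" "0 \<le> 1 / speed \<phi> (z0 + y) ^ 3"
      using s s0_pos by (auto intro!: divide_nonneg_nonneg)
    ultimately show "\<bar>3 * (z0 + y)\<^sup>2 / speed \<phi> (z0 + y) ^ 5 - 1 / speed \<phi> (z0 + y) ^ 3\<bar> \<le> ?B"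
      by linarith
  qed
  then show "\<bar>- (z0 + x) / speed \<phi> (z0 + x) ^ 3 - delay' \<phi>\<bar> \<le> ?B * \<bar>x\<bar>"
    by (simp add: delay'_def)
qed

text \<open>The estimate is global in x because \<gamma> is defined on the whole line; the radius in
  \<open>linearization_bound\<close> is taken to be \<open>e\<close> itself.\<close>

lemma force_linear:
  assumes "\<And>t. \<bar>deriv (deriv \<gamma>) t\<bar> \<le> B" "\<bar>x\<bar> \<le> e" "\<bar>y\<bar> \<le> e"
  shows "\<bar>force \<phi> x - force \<phi> y - force' \<phi> * (x - y)\<bar> \<le> 2 * B * e * \<bar>x - y\<bar>"
proof (rule linearization_bound[OF _ _ assms(2,3) order_refl])
  let ?a = "t0 \<phi> + \<alpha>\<^sub>0"
  have D: "((\<lambda>x. \<gamma> (?a + x)) has_real_derivative deriv \<gamma> (?a + x)) (at x)"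
    "((\<lambda>x. deriv \<gamma> (?a + x)) has_real_derivative deriv (deriv \<gamma>) (?a + x)) (at x)" for x
    using DERIV_chain2[OF deriv_\<gamma>(1) DERIV_add[OF DERIV_const DERIV_ident], of ?a x]
      DERIV_chain2[OF deriv_\<gamma>(2) DERIV_add[OF DERIV_const DERIV_ident], of ?a x] by simp_all
  show "(force \<phi> has_real_derivative 2 * deriv \<gamma> (?a + x)) (at x)" for x
    unfolding force_def[abs_def] by (rule DERIV_cmult[OF D(1)])
  show "\<bar>2 * deriv \<gamma> (?a + x) - force' \<phi>\<bar> \<le> 2 * B * \<bar>x\<bar>" for x
    using lipschitz_from_derivative[OF D(2) assms(1), of x "\<bar>x\<bar>" 0] by (simp add: force'_def)
  show "0 \<le> 2 * B" using assms(1)[of 0] by simp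
qed

lemma continuous_delay: "continuous_on (UNIV \<times> {-r..r}) (\<lambda>(\<phi>, y). delay \<phi> y)"
proof -
  have "speed \<phi> (z0 + y) \<noteq> 0" "speed \<phi> z0 \<noteq> 0" if "y \<in> {-r..r}" for \<phi> y
    using speed_pos[of "z0 + y" \<phi>] speed_pos[of z0 \<phi>] that r_pos by (auto simp: abs_le_iff)
  then show ?thesis
    unfolding delay_def split_def speed_def by (auto intro!: continuous_intros)
qed

lemma continuous_delay': "continuous_on UNIV delay'"
proof -
  have "speed \<phi> z0 \<noteq> 0" for \<phi> using speed_pos[of z0 \<phi>] r_pos by auto
  then show ?thesis
    unfolding delay'_def[abs_def] speed_def by (auto intro!: continuous_intros)
qed

text \<open>The mean conditions are the point: \<open>delay\<close> vanishes at 0 and its derivative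
  there is negative for every angle, while for \<open>force\<close> the two means are, up to
  positive factors, the Melnikov integral and its derivative in
  \<open>\<alpha>\<^sub>0\<close>.\<close>

lemma exists_M:
  obtains M where "coupled_nonlinearities L r M delay delay' force force'"
proof -
  have \<gamma>'_periodic: "periodic 1 (deriv \<gamma>)"
    using periodic_derivative[OF \<gamma>_periodic] \<gamma>_C2 by (simp add: C2_real_def)
  have \<gamma>''_periodic: "periodic 1 (deriv (deriv \<gamma>))"
    using periodic_derivative[OF \<gamma>'_periodic] \<gamma>_C2 by (simp add: C2_real_def)
  obtain B0 where B0: "0 < B0" "\<And>t. \<bar>\<gamma> t\<bar> \<le> B0"
    using periodic_bounded[OF \<gamma>_periodic _ continuous_\<gamma>(1)] by auto
  obtain B1 where B1: "0 < B1" "\<And>t. \<bar>deriv \<gamma> t\<bar> \<le> B1"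
    using periodic_bounded[OF \<gamma>'_periodic _ continuous_\<gamma>(2)] by auto
  obtain B2 where B2: "0 < B2" "\<And>t. \<bar>deriv (deriv \<gamma>) t\<bar> \<le> B2"
    using periodic_bounded[OF \<gamma>''_periodic _ continuous_deriv2_\<gamma>] by auto
  define Bd where "Bd = 1 / s0 ^ 3 + 3 * (z0 + 1)\<^sup>2 / s0 ^ 5"
  have Bd: "0 < Bd" "0 < z0 / s0 ^ 3"
    unfolding Bd_def using s0_pos z0_pos by (auto intro!: add_pos_nonneg)
  define M where "M = z0 / s0 ^ 3 + Bd + 2 * B0 + 2 * B1 + 2 * B2"
  have s_z0: "s0 \<le> speed \<phi> z0" for \<phi>
    using speed_ge[of z0] r_pos by simp
  have delay'_bound: "\<bar>delay' \<phi>\<bar> \<le> z0 / s0 ^ 3" for \<phi>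
    using s_z0[of \<phi>] s0_pos z0_pos unfolding delay'_def
    by (auto simp: abs_divide power_abs intro!: divide_left_mono power_mono mult_pos_pos)
  have "coupled_nonlinearities L r M delay delay' force force'"
  proof
    show "0 < L" "0 < r" "r \<le> 1" by (fact L_pos r_pos r_le_1)+
    show "0 < M" using Bd B0 B1 B2 by (simp add: M_def)
    show "continuous_on (UNIV \<times> {-r..r}) (\<lambda>(t, x). delay t x)" by (rule continuous_delay)
    show "continuous_on UNIV delay'" by (rule continuous_delay')
    show "delay (t + L) x = delay t x" for t x by (simp add: delay_def speed_add L_def)
    show "delay t 0 = 0" for t by (simp add: delay_def)
    then show "\<bar>delay t 0\<bar> \<le> M" "mean L (\<lambda>t. delay t 0) = 0" for t
      using \<open>0 < M\<close> mean_cmult[OF continuous_on_const, of L 0 0] by auto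
    show "\<bar>delay' t\<bar> \<le> M" for t
      using delay'_bound[of t] Bd B0(1) B1(1) B2(1) by (simp add: M_def)
    show "\<bar>delay t x - delay t y - delay' t * (x - y)\<bar> \<le> M * e * \<bar>x - y\<bar>"
      if "\<bar>x\<bar> \<le> e" "\<bar>y\<bar> \<le> e" "e \<le> r" for t x y e
    proof -
      have "Bd * e * \<bar>x - y\<bar> \<le> M * e * \<bar>x - y\<bar>"
        using that Bd B0(1) B1(1) B2(1) by (intro mult_right_mono) (auto simp: M_def)
      then show ?thesis using delay_linear[OF that, of t] by (simp add: Bd_def)
    qed
    have "delay' t < 0" for t
      using z0_pos s_z0[of t] s0_pos by (simp add: delay'_def)
    then show "mean L delay' \<noteq> 0"
      using mean_neg[OF L_pos continuous_delay'] by simp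
    show "continuous_on (UNIV \<times> {-r..r}) (\<lambda>(t, x). force t x)"
      unfolding force_def split_def
      by (intro continuous_intros continuous_on_compose2[OF continuous_\<gamma>(1)[of UNIV]]
          continuous_on_compose2[OF continuous_t0[of UNIV]]) auto
    show cf': "continuous_on UNIV force'"
      unfolding force'_def[abs_def]
      by (intro continuous_intros continuous_on_compose2[OF continuous_\<gamma>(2)[of UNIV]] continuous_t0) auto
    show "force (t + L) x = force t x" for t x
      using \<gamma>_p[of "t0 t + \<alpha>\<^sub>0 + x"] by (simp add: force_def t0_add algebra_simps)
    show "\<bar>force t 0\<bar> \<le> M" for t
      using B0(2)[of "t0 t + \<alpha>\<^sub>0"] Bd B1(1) B2(1) by (simp add: force_def M_def)
    show "\<bar>force' t\<bar> \<le> M" for t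
      using B1(2)[of "t0 t + \<alpha>\<^sub>0"] Bd B0(1) B2(1) by (simp add: force'_def M_def)
    show "\<bar>force t x - force t y - force' t * (x - y)\<bar> \<le> M * e * \<bar>x - y\<bar>"
      if "\<bar>x\<bar> \<le> e" "\<bar>y\<bar> \<le> e" "e \<le> r" for t x y e
    proof -
      have "2 * B2 * e * \<bar>x - y\<bar> \<le> M * e * \<bar>x - y\<bar>"
        using that Bd B0(1) B1(1) B2(1) by (intro mult_right_mono) (auto simp: M_def)
      then show ?thesis using force_linear[OF B2(2) that(1,2), of t] by simp
    qed
    have ch: "continuous_on UNIV (\<lambda>\<phi>. \<gamma> (t0 \<phi> + \<alpha>\<^sub>0))" "continuous_on UNIV (\<lambda>\<phi>. deriv \<gamma> (t0 \<phi> + \<alpha>\<^sub>0))"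
      by (intro continuous_intros continuous_on_compose2[OF continuous_\<gamma>(1)[of UNIV]]
          continuous_on_compose2[OF continuous_\<gamma>(2)[of UNIV]] continuous_t0; simp)+
    show "mean L (\<lambda>t. force t 0) = 0"
      using melnikov dn_integral[OF continuous_\<gamma>(1)] mean_cmult[OF ch(1), of L 2] c_pos k_pos L_pos
      by (simp add: force_def)
    show "mean L force' \<noteq> 0"
      using melnikov' dn_integral[OF continuous_\<gamma>(2)] mean_cmult[OF ch(2), of L 2] c_pos k_pos L_pos
      by (simp add: force'_def[abs_def])
  qed
  then show ?thesis by (rule that)
qed

end

section \<open>From angle to time\<close>

lemma DERIV_uminus_iff: "(f has_real_derivative D) (at t) \<longleftrightarrow> ((\<lambda>t. - f t) has_real_derivative - D) (at t)"
  for f :: "real \<Rightarrow> real"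
  using DERIV_minus[of f D t] DERIV_minus[of "\<lambda>t. - f t" "- D" t] by auto

context forced_pendulum
begin

text \<open>The unknowns \<open>x\<close>, \<open>y\<close> are the deviations of time and of \<open>z\<close>, as functions of the angle.\<close>

definition angle_solution :: "real \<Rightarrow> real \<Rightarrow> (real \<Rightarrow> real) \<Rightarrow> (real \<Rightarrow> real) \<Rightarrow> bool" where
  "angle_solution \<epsilon> \<rho> x y \<longleftrightarrow> periodic L x \<and> periodic L y \<and> (\<forall>\<phi>. \<bar>x \<phi>\<bar> \<le> \<rho> \<and> \<bar>y \<phi>\<bar> \<le> \<rho>) \<and>
     (\<forall>\<phi>. (x has_real_derivative delay \<phi> (y \<phi>)) (at \<phi>) \<and>
       (y has_real_derivative \<epsilon> * force \<phi> (x \<phi>)) (at \<phi>))"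

text \<open>Stated along the curve, without an inverse function; surjectivity of the time map makes
  \<open>x\<close> and \<open>y\<close> determine \<psi> and z at every instant.\<close>

definition corresponds :: "(real \<Rightarrow> real) \<Rightarrow> (real \<Rightarrow> real) \<Rightarrow> (real \<Rightarrow> real) \<Rightarrow> (real \<Rightarrow> real) \<Rightarrow> bool" where
  "corresponds x y \<psi> z \<longleftrightarrow> surj (\<lambda>\<phi>. t0 \<phi> + \<alpha>\<^sub>0 + x \<phi>) \<and>
     (\<forall>\<phi>. \<psi> (t0 \<phi> + \<alpha>\<^sub>0 + x \<phi>) = pi + 2 * \<phi> \<and> z (t0 \<phi> + \<alpha>\<^sub>0 + x \<phi>) = z0 + y \<phi>)"

definition perturbed :: "real \<Rightarrow> real \<Rightarrow> real \<Rightarrow> (real \<Rightarrow> real) \<Rightarrow> (real \<Rightarrow> real) \<Rightarrow> bool" where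
  "perturbed \<epsilon> \<rho> s \<psi> z \<longleftrightarrow> is_solution c \<gamma> \<epsilon> \<psi> z \<and> shift_periodic p q \<psi> z \<and>
     on_level_set c d \<psi> z \<and> uniformly_within \<rho> (leading_term k c d \<alpha>\<^sub>0 s) \<psi> z"

lemma corresponds_unique:
  assumes "corresponds x y \<psi> z" "corresponds x y \<psi>' z'"
  shows "\<psi> = \<psi>'" "z = z'"
proof -
  have "\<psi> t = \<psi>' t \<and> z t = z' t" for t
  proof -
    obtain \<phi> where "t = t0 \<phi> + \<alpha>\<^sub>0 + x \<phi>"
      using assms(1) unfolding corresponds_def surj_def by blast
    then show ?thesis using assms by (simp add: corresponds_def)
  qed
  then show "\<psi> = \<psi>'" "z = z'" by auto
qed

lemma ex1_angle_solution:
  obtains R0 where "0 < R0" "\<And>R. R0 \<le> R \<Longrightarrow> \<exists>\<delta>>0. \<forall>\<epsilon>. \<epsilon> \<noteq> 0 \<and> \<bar>\<epsilon>\<bar> < \<delta> \<longrightarrow>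
      (\<exists>!u. angle_solution \<epsilon> (R * \<bar>\<epsilon>\<bar>) (fst u) (snd u))"
proof -
  obtain M where M: "coupled_nonlinearities L r M delay delay' force force'"
    using exists_M .
  interpret coupled_nonlinearities L r M delay delay' force force' by (rule M)
  have *: "admissible \<rho> x \<and> admissible \<rho> y \<and> solves \<epsilon> x y \<longleftrightarrow> angle_solution \<epsilon> \<rho> x y" for \<rho> \<epsilon> x y
  proof -
    have "continuous_on UNIV x \<and> continuous_on UNIV y" if "solves \<epsilon> x y"
      using that unfolding solves_def by (meson DERIV_isCont continuous_at_imp_continuous_on)
    then show ?thesis
      unfolding admissible_def angle_solution_def solves_def by blast
  qed
  show ?thesis
    using ex1_periodic_solution that unfolding * by metis
qed

text \<open>The derivative dn is at most 1. This turns a deviation in time into one in the angle;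
  \<open>t0_lipschitz\<close> serves for the opposite direction.\<close>

lemma am_lipschitz: "\<bar>jacobi_am u k - jacobi_am v k\<bar> \<le> \<bar>u - v\<bar>"
proof -
  have "norm (jacobi_am u k - jacobi_am v k) \<le> 1 * norm (u - v)"
  proof (rule field_differentiable_bound[of UNIV])
    show "((\<lambda>u. jacobi_am u k) has_field_derivative jacobi_dn z k) (at z within UNIV)" for z
      using am_has_derivative by simp
    show "norm (jacobi_dn z k) \<le> 1" for z
    proof -
      have "0 \<le> jacobi_dn z k" using w_pos[of "jacobi_am z k"] by (simp add: jacobi_dn_def w_def)
      moreover have "jacobi_dn z k \<le> 1" by (simp add: jacobi_dn_def)
      ultimately show ?thesis by simp
    qed
  qed auto
  then show ?thesis by simp
qed

lemma t0_lipschitz: "\<bar>t0 \<phi> - t0 \<phi>'\<bar> \<le> 1 / s0 * \<bar>\<phi> - \<phi>'\<bar>"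
proof -
  have "norm (t0 \<phi> - t0 \<phi>') \<le> 1 / s0 * norm (\<phi> - \<phi>')"
  proof (rule field_differentiable_bound[of UNIV])
    show "(t0 has_field_derivative 1 / speed z z0) (at z within UNIV)" for z
      using t0_has_derivative by simp
    show "norm (1 / speed z z0) \<le> 1 / s0" for z
      using speed_ge[of z0 z] r_pos s0_pos by (auto intro!: divide_left_mono mult_pos_pos)
  qed auto
  then show ?thesis by simp
qed

section \<open>Passage between solutions in time and solutions in the angle\<close>

lemma leading_term_eq:
  "leading_term k c d \<alpha>\<^sub>0 s t = (pi + 2 * jacobi_am (2 * c * (t - \<alpha>\<^sub>0) / k) k, s * z0)"
  by (simp add: leading_term_def psi_l_def z0_def m_def)

lemma within_bounds:
  assumes "uniformly_within \<rho> (leading_term k c d \<alpha>\<^sub>0 s) \<psi> z"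
  shows "\<bar>\<psi> t - (pi + 2 * jacobi_am (2 * c * (t - \<alpha>\<^sub>0) / k) k)\<bar> \<le> \<rho>" "\<bar>z t - s * z0\<bar> \<le> \<rho>"
proof -
  have d: "dist (\<psi> t, z t) (leading_term k c d \<alpha>\<^sub>0 s t) \<le> \<rho>"
    using assms by (simp add: uniformly_within_def)
  show "\<bar>\<psi> t - (pi + 2 * jacobi_am (2 * c * (t - \<alpha>\<^sub>0) / k) k)\<bar> \<le> \<rho>" "\<bar>z t - s * z0\<bar> \<le> \<rho>"
    using order_trans[OF dist_fst_le d] order_trans[OF dist_snd_le d]
    by (simp_all add: leading_term_eq dist_real_def)
qed

text \<open>The level set determines only the square of the derivative. As the speed is positive,
  the derivative never vanishes and has constant sign by the intermediate value theorem; the sign is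
  positive because \<psi> gains 2 pi q over the time p.\<close>

lemma perturbed_speed:
  assumes "perturbed \<epsilon> \<rho> 1 \<psi> z" "\<rho> \<le> r"
  shows "deriv \<psi> t = 2 * speed ((\<psi> t - pi) / 2) (z t)"
proof -
  have sol: "is_solution c \<gamma> \<epsilon> \<psi> z" and per: "shift_periodic p q \<psi> z" and lev: "on_level_set c d \<psi> z"
    and wi: "uniformly_within \<rho> (leading_term k c d \<alpha>\<^sub>0 1) \<psi> z"
    using assms by (auto simp: perturbed_def)
  have z: "\<bar>z t - z0\<bar> \<le> r" for t
    using within_bounds(2)[OF wi, of t] assms(2) by simp
  have sq: "(deriv \<psi> t)\<^sup>2 = (2 * speed ((\<psi> t - pi) / 2) (z t))\<^sup>2" for t
  proof -
    define \<phi> where "\<phi> = (\<psi> t - pi) / 2"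
    then have "\<psi> t = pi + 2 * \<phi>" by (simp add: field_simps)
    then have cos: "cos (\<psi> t) = 1 - 2 * (cos \<phi>)\<^sup>2"
      by (simp add: cos_add cos_double_cos)
    show ?thesis
      using lev[unfolded on_level_set_def, rule_format, of t, unfolded cos]
      unfolding power_mult_distrib speed_sq[OF z] \<phi>_def[symmetric] by (simp add: algebra_simps)
  qed
  have pos: "0 < 2 * speed ((\<psi> t - pi) / 2) (z t)" for t
    using speed_pos[OF z] by simp
  then have nz: "deriv \<psi> t \<noteq> 0" for t
    using sq[of t] by (metis less_irrefl zero_eq_power2)
  have cont: "isCont (deriv \<psi>) t" for t
    using sol DERIV_isCont unfolding is_solution_def by blast
  have D: "(\<psi> has_real_derivative deriv \<psi> t) (at t)" for t
    using sol by (simp add: is_solution_def DERIV_deriv_iff_real_differentiable)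
  obtain \<xi> where "\<psi> (real p) - \<psi> 0 = (real p - 0) * deriv \<psi> \<xi>"
    using MVT2[of 0 "real p" \<psi> "deriv \<psi>"] D p_pos by auto
  moreover have "\<psi> (real p) - \<psi> 0 = 2 * pi * real q"
    using per[unfolded shift_periodic_def, rule_format, of 0] by simp
  moreover have "0 < 2 * pi * real q" using q_pos by simp
  ultimately have "0 < real p * deriv \<psi> \<xi>" by (metis diff_zero)
  then have \<xi>: "0 < deriv \<psi> \<xi>" using p_pos by (simp add: zero_less_mult_iff)
  have "0 < deriv \<psi> t"
  proof (rule ccontr)
    assume "\<not> 0 < deriv \<psi> t"
    then have le: "deriv \<psi> t \<le> 0" by simp
    have "\<exists>u. deriv \<psi> u = 0"
    proof (cases "t \<le> \<xi>")
      case True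
      then show ?thesis using IVT[of "deriv \<psi>" t 0 \<xi>] le \<xi> cont by auto
    next
      case False
      then show ?thesis using IVT2[of "deriv \<psi>" t 0 \<xi>] le \<xi> cont by auto
    qed
    then show False using nz by blast
  qed
  then show ?thesis
    using power2_eq_imp_eq[OF sq[of t]] pos[of t] by simp
qed

text \<open>The angle increases strictly, so time becomes a function of it. In the factor
  \<open>1 + 1 / s0\<close> the 1 covers z, and \<open>1 / s0\<close> covers the time through
  \<open>t0_lipschitz\<close>.\<close>

lemma perturbed_imp_angle_solution:
  assumes pert: "perturbed \<epsilon> \<rho> 1 \<psi> z" and \<rho>: "\<rho> \<le> r"
  obtains x y where "angle_solution \<epsilon> (\<rho> * (1 + 1 / s0)) x y" "corresponds x y \<psi> z"
proof -
  have sol: "is_solution c \<gamma> \<epsilon> \<psi> z" and per: "shift_periodic p q \<psi> z"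
    and wi: "uniformly_within \<rho> (leading_term k c d \<alpha>\<^sub>0 1) \<psi> z"
    using assms by (auto simp: perturbed_def)
  have z: "\<bar>z t - z0\<bar> \<le> \<rho>" for t
    using within_bounds(2)[OF wi, of t] by simp
  have zr: "\<bar>z t - z0\<bar> \<le> r" for t
    using z[of t] \<rho> by linarith
  have "0 \<le> \<rho>" using z[of 0] by linarith
  define f where "f t = (\<psi> t - pi) / 2" for t
  have Df: "(f has_real_derivative speed (f t) (z t)) (at t)" for t
  proof -
    have "(\<psi> has_real_derivative deriv \<psi> t) (at t)"
      using sol by (simp add: is_solution_def DERIV_deriv_iff_real_differentiable)
    from DERIV_cdivide[OF DERIV_diff[OF this DERIV_const], of pi 2] show ?thesis
      by (simp add: f_def[abs_def] perturbed_speed[OF assms])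
  qed
  have f_shift: "f (t + real p) = f t + L" for t
    using per by (simp add: shift_periodic_def f_def L_def field_simps)
  obtain g where gf: "\<And>t. g (f t) = t" and fg: "\<And>\<phi>. f (g \<phi>) = \<phi>"
    and Dg: "\<And>\<phi>. (g has_real_derivative 1 / speed (f (g \<phi>)) (z (g \<phi>))) (at \<phi>)"
    and g_shift: "\<And>\<phi>. g (\<phi> + L) = g \<phi> + real p"
    by (rule increasing_inverse[OF Df speed_pos[OF zr] f_shift L_pos]) blast
  define x where "x \<phi> = g \<phi> - t0 \<phi> - \<alpha>\<^sub>0" for \<phi>
  define y where "y \<phi> = z (g \<phi>) - z0" for \<phi>
  have g_eq: "t0 \<phi> + \<alpha>\<^sub>0 + x \<phi> = g \<phi>" for \<phi> by (simp add: x_def)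
  have "corresponds x y \<psi> z"
    unfolding corresponds_def g_eq
  proof (intro conjI allI)
    show "surj g" using gf by (metis surjI)
    show "\<psi> (g \<phi>) = pi + 2 * \<phi>" for \<phi> using fg[of \<phi>] by (simp add: f_def field_simps)
    show "z (g \<phi>) = z0 + y \<phi>" for \<phi> by (simp add: y_def)
  qed
  moreover have "angle_solution \<epsilon> (\<rho> * (1 + 1 / s0)) x y"
    unfolding angle_solution_def
  proof (intro conjI allI)
    show "periodic L x" by (simp add: periodic_def x_def g_shift t0_add)
    show "periodic L y" using per by (simp add: periodic_def y_def g_shift shift_periodic_def)
    fix \<phi>
    have "\<bar>y \<phi>\<bar> \<le> \<rho> * 1" using z by (simp add: y_def)
    also have "\<dots> \<le> \<rho> * (1 + 1 / s0)" using \<open>0 \<le> \<rho>\<close> s0_pos by (intro mult_left_mono) auto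
    finally show "\<bar>y \<phi>\<bar> \<le> \<rho> * (1 + 1 / s0)" .
    \<comment> \<open>The angle of the unperturbed orbit at the instant when the given solution has
      angle \<phi>; the time deviation is then a difference of two values of
      \<open>t0\<close>.\<close>
    define \<phi>' where "\<phi>' = jacobi_am (2 * c * (g \<phi> - \<alpha>\<^sub>0) / k) k"
    have "\<bar>2 * \<phi> - 2 * \<phi>'\<bar> \<le> \<rho>"
      using within_bounds(1)[OF wi, of "g \<phi>"] fg[of \<phi>] by (simp add: \<phi>'_def f_def field_simps)
    then have "\<bar>\<phi>' - \<phi>\<bar> \<le> \<rho>" by linarith
    have "x \<phi> = t0 \<phi>' - t0 \<phi>" by (simp add: x_def \<phi>'_def t0_am)
    also have "\<bar>\<dots>\<bar> \<le> 1 / s0 * \<bar>\<phi>' - \<phi>\<bar>" by (rule t0_lipschitz)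
    also have "\<dots> \<le> 1 / s0 * \<rho>" using s0_pos \<open>\<bar>\<phi>' - \<phi>\<bar> \<le> \<rho>\<close> by (intro mult_left_mono) auto
    also have "\<dots> \<le> \<rho> * (1 + 1 / s0)" using \<open>0 \<le> \<rho>\<close> by (simp add: algebra_simps)
    finally show "\<bar>x \<phi>\<bar> \<le> \<rho> * (1 + 1 / s0)" .
    show "(x has_real_derivative delay \<phi> (y \<phi>)) (at \<phi>)"
      using DERIV_diff[OF DERIV_diff[OF Dg t0_has_derivative] DERIV_const, of \<alpha>\<^sub>0 \<phi>]
      by (simp add: x_def[abs_def] delay_def y_def fg)
    have "(z has_real_derivative \<epsilon> * \<gamma> (g \<phi>) * deriv \<psi> (g \<phi>)) (at (g \<phi>))"
      using sol by (simp add: is_solution_def)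
    from DERIV_diff[OF DERIV_chain2[OF this Dg] DERIV_const, of z0]
    show "(y has_real_derivative \<epsilon> * force \<phi> (x \<phi>)) (at \<phi>)"
      unfolding y_def[abs_def]
      by (rule DERIV_cong) (use speed_pos[OF zr, of "f (g \<phi>)" "g \<phi>"] in
          \<open>simp add: perturbed_speed[OF assms] force_def g_eq flip: f_def\<close>)
  qed
  ultimately show ?thesis using that by blast
qed

text \<open>Inverting the time map recovers the angle as a function of time. In the radius, 2 c / k
  is the scaling of the argument of the amplitude, doubled because \<psi> is twice the angle plus
  pi, and the 1 accounts for z.\<close>

lemma angle_solution_imp_perturbed:
  assumes ang: "angle_solution \<epsilon> \<rho> x y" and \<rho>: "\<rho> \<le> r"
  obtains \<psi> z where "perturbed \<epsilon> ((4 * c / k + 1) * \<rho>) 1 \<psi> z" "corresponds x y \<psi> z"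
proof -
  have xy: "periodic L x" "periodic L y" "\<And>\<phi>. \<bar>x \<phi>\<bar> \<le> \<rho>" "\<And>\<phi>. \<bar>y \<phi>\<bar> \<le> \<rho>"
    and Dx: "\<And>\<phi>. (x has_real_derivative delay \<phi> (y \<phi>)) (at \<phi>)"
    and Dy: "\<And>\<phi>. (y has_real_derivative \<epsilon> * force \<phi> (x \<phi>)) (at \<phi>)"
    using ang unfolding angle_solution_def by blast+
  have yr: "\<bar>(z0 + y \<phi>) - z0\<bar> \<le> r" for \<phi>
    using xy(4)[of \<phi>] \<rho> by simp
  define g where "g \<phi> = t0 \<phi> + \<alpha>\<^sub>0 + x \<phi>" for \<phi>
  have Dg: "(g has_real_derivative 1 / speed \<phi> (z0 + y \<phi>)) (at \<phi>)" for \<phi>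
    using DERIV_add[OF DERIV_add[OF t0_has_derivative DERIV_const] Dx, of \<alpha>\<^sub>0 \<phi>]
    by (simp add: g_def[abs_def] delay_def)
  have g_shift: "g (\<phi> + L) = g \<phi> + real p" for \<phi>
    using xy(1) by (simp add: g_def t0_add periodic_def)
  have g_pos: "0 < 1 / speed \<phi> (z0 + y \<phi>)" for \<phi> using speed_pos[OF yr] by simp
  have "0 < real p" using p_pos by simp
  obtain f where fg: "\<And>\<phi>. f (g \<phi>) = \<phi>" and gf: "\<And>t. g (f t) = t"
    and Df: "\<And>t. (f has_real_derivative 1 / (1 / speed (f t) (z0 + y (f t)))) (at t)"
    and f_shift: "\<And>t. f (t + real p) = f t + L"
    by (rule increasing_inverse[OF Dg g_pos g_shift \<open>0 < real p\<close>]) blast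
  define \<psi> where "\<psi> t = pi + 2 * f t" for t
  define z where "z t = z0 + y (f t)" for t
  have zr: "\<bar>z t - z0\<bar> \<le> r" for t unfolding z_def by (rule yr)
  define v where "v t = speed (f t) (z t)" for t
  have v_pos: "0 < v t" for t unfolding v_def by (rule speed_pos[OF zr])
  have v_sq: "(v t)\<^sup>2 = d / 2 + (z t)\<^sup>2 + 4 * c\<^sup>2 * (cos (f t))\<^sup>2" for t
    unfolding v_def by (rule speed_sq[OF zr])
  have Df': "(f has_real_derivative v t) (at t)" for t
    using Df[of t] by (simp add: v_def z_def)
  have D\<psi>: "(\<psi> has_real_derivative 2 * v t) (at t)" for t
    unfolding \<psi>_def[abs_def] by (auto intro!: derivative_eq_intros Df')
  have deriv\<psi>: "deriv \<psi> = (\<lambda>t. 2 * v t)"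
    using D\<psi> DERIV_imp_deriv by blast
  have Dz: "(z has_real_derivative \<epsilon> * \<gamma> t * (2 * v t)) (at t)" for t
    using DERIV_add[OF DERIV_const DERIV_chain2[OF Dy Df'], of z0 t] gf[of t]
    by (simp add: z_def[abs_def] force_def g_def mult.assoc mult.left_commute)
  have Dv: "((\<lambda>t. 2 * v t) has_real_derivative 4 * (c\<^sup>2 * sin (\<psi> t) + \<epsilon> * \<gamma> t * z t)) (at t)" for t
  proof -
    \<comment> \<open>\<open>?u\<close> is the square of \<open>v\<close>, and its derivative has
      the factor \<open>v\<close>; differentiating the square root divides it out, which gives the
      second-order equation.\<close>
    let ?u = "\<lambda>t. d / 2 + (z t)\<^sup>2 + 4 * c\<^sup>2 * (cos (f t))\<^sup>2"
    have "0 < ?u t" using v_sq[of t] v_pos[of t] by (metis zero_less_power2 less_irrefl)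
    have "(?u has_real_derivative 2 * z t * (\<epsilon> * \<gamma> t * (2 * v t)) - 8 * c\<^sup>2 * cos (f t) * sin (f t) * v t) (at t)"
      by (auto intro!: derivative_eq_intros Dz Df')
    from DERIV_cmult[OF DERIV_chain2[OF DERIV_real_sqrt[OF \<open>0 < ?u t\<close>] this], of 2]
    have "((\<lambda>t. 2 * v t) has_real_derivative
        2 * (inverse (v t) / 2 * (2 * z t * (\<epsilon> * \<gamma> t * (2 * v t)) - 8 * c\<^sup>2 * cos (f t) * sin (f t) * v t))) (at t)"
      by (simp add: v_def[abs_def] speed_def)
    moreover have "sin (\<psi> t) = - 2 * sin (f t) * cos (f t)"
      unfolding \<psi>_def sin_add sin_double by simp
    ultimately show ?thesis
      by (elim DERIV_cong) (use v_pos[of t] in \<open>simp add: field_simps\<close>)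
  qed
  have cos: "cos (\<psi> t) = 1 - 2 * (cos (f t))\<^sup>2" for t
    unfolding \<psi>_def cos_add cos_double_cos by simp
  have "corresponds x y \<psi> z"
    unfolding corresponds_def g_def[symmetric]
    using surjI[of g f, OF gf] by (simp add: \<psi>_def z_def fg)
  moreover have "is_solution c \<gamma> \<epsilon> \<psi> z"
    unfolding is_solution_def deriv\<psi> using D\<psi> Dv Dz real_differentiable_def by blast
  moreover have "shift_periodic p q \<psi> z"
    using xy(2) by (simp add: shift_periodic_def \<psi>_def z_def f_shift L_def periodic_def)
  moreover have "on_level_set c d \<psi> z"
    unfolding on_level_set_def deriv\<psi> cos power_mult_distrib v_sq by (simp add: algebra_simps)
  moreover have "uniformly_within ((4 * c / k + 1) * \<rho>) (leading_term k c d \<alpha>\<^sub>0 1) \<psi> z"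
    unfolding uniformly_within_def
  proof
    fix t
    let ?l = "jacobi_am (2 * c * (t - \<alpha>\<^sub>0) / k) k"
    have "f t = jacobi_am (2 * c * t0 (f t) / k) k" by (simp add: am_t0)
    then have "\<bar>f t - ?l\<bar> \<le> \<bar>2 * c * t0 (f t) / k - 2 * c * (t - \<alpha>\<^sub>0) / k\<bar>"
      using am_lipschitz by metis
    also have "\<dots> = \<bar>2 * c / k * (t0 (f t) - (t - \<alpha>\<^sub>0))\<bar>"
      by (simp add: right_diff_distrib diff_divide_distrib)
    also have "t0 (f t) - (t - \<alpha>\<^sub>0) = - x (f t)" using gf[of t] by (simp add: g_def)
    also have "\<bar>2 * c / k * - x (f t)\<bar> = 2 * c / k * \<bar>x (f t)\<bar>"
      using c_pos k_pos by (simp add: abs_mult)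
    also have "\<dots> \<le> 2 * c / k * \<rho>" using c_pos k_pos xy(3) by (intro mult_left_mono) auto
    finally have "\<bar>\<psi> t - (pi + 2 * ?l)\<bar> \<le> 4 * c / k * \<rho>" by (simp add: \<psi>_def)
    moreover have "\<bar>z t - z0\<bar> \<le> \<rho>" using xy(4) by (simp add: z_def)
    moreover have "dist (\<psi> t, z t) (leading_term k c d \<alpha>\<^sub>0 1 t) \<le> \<bar>\<psi> t - (pi + 2 * ?l)\<bar> + \<bar>z t - z0\<bar>"
      unfolding leading_term_eq dist_prod_def
      using sqrt_sum_squares_le_sum[of "\<bar>\<psi> t - (pi + 2 * ?l)\<bar>" "\<bar>z t - z0\<bar>"] by (simp add: dist_real_def)
    ultimately show "dist (\<psi> t, z t) (leading_term k c d \<alpha>\<^sub>0 1 t) \<le> (4 * c / k + 1) * \<rho>"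
      by (simp add: algebra_simps)
  qed
  ultimately show ?thesis using that unfolding perturbed_def by blast
qed

section \<open>Existence and uniqueness for both signs\<close>

lemma perturbed_mono: "perturbed \<epsilon> \<rho> s \<psi> z \<Longrightarrow> \<rho> \<le> \<rho>' \<Longrightarrow> perturbed \<epsilon> \<rho>' s \<psi> z"
  unfolding perturbed_def uniformly_within_def using order_trans by blast

lemma angle_solution_mono:
  "angle_solution \<epsilon> \<rho> x y \<Longrightarrow> \<rho> \<le> \<rho>' \<Longrightarrow> angle_solution \<epsilon> \<rho>' x y"
  unfolding angle_solution_def using order_trans by blast

text \<open>Closeness in time and closeness in the angle variables agree only up to constants.
  Existence is therefore taken in the ball belonging to \<open>R0\<close>, and uniqueness in the one
  belonging to \<open>R\<close>, which contains the angle form of every candidate within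
  \<open>C * \<bar>\<epsilon>\<bar>\<close>.\<close>

lemma ex1_perturbed:
  obtains C\<^sub>0 where "0 < C\<^sub>0" "\<And>C. C\<^sub>0 \<le> C \<Longrightarrow> \<exists>\<delta>>0. \<forall>\<epsilon>. \<epsilon> \<noteq> 0 \<and> \<bar>\<epsilon>\<bar> < \<delta> \<longrightarrow>
      (\<exists>!u. perturbed \<epsilon> (C * \<bar>\<epsilon>\<bar>) 1 (fst u) (snd u))"
proof -
  obtain R0 where R0: "0 < R0" "\<And>R. R0 \<le> R \<Longrightarrow> \<exists>\<delta>>0. \<forall>\<epsilon>. \<epsilon> \<noteq> 0 \<and> \<bar>\<epsilon>\<bar> < \<delta> \<longrightarrow>
      (\<exists>!u. angle_solution \<epsilon> (R * \<bar>\<epsilon>\<bar>) (fst u) (snd u))"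
    using ex1_angle_solution by blast
  have a: "0 < 4 * c / k + 1" using c_pos k_pos by (simp add: add_pos_pos)
  show ?thesis
  proof
    show "0 < (4 * c / k + 1) * R0" using a R0(1) by simp
    fix C assume C: "(4 * c / k + 1) * R0 \<le> C"
    then have C_pos: "0 < C" using a R0(1) by (meson less_le_trans mult_pos_pos)
    define R where "R = max R0 (C * (1 + 1 / s0))"
    have R: "R0 \<le> R" "C * (1 + 1 / s0) \<le> R" by (auto simp: R_def)
    obtain \<delta>\<^sub>1 where \<delta>\<^sub>1: "0 < \<delta>\<^sub>1" "\<And>\<epsilon>. \<epsilon> \<noteq> 0 \<Longrightarrow> \<bar>\<epsilon>\<bar> < \<delta>\<^sub>1 \<Longrightarrow> \<exists>!u. angle_solution \<epsilon> (R0 * \<bar>\<epsilon>\<bar>) (fst u) (snd u)"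
      using R0(2)[OF order_refl] by blast
    obtain \<delta>\<^sub>2 where \<delta>\<^sub>2: "0 < \<delta>\<^sub>2" "\<And>\<epsilon>. \<epsilon> \<noteq> 0 \<Longrightarrow> \<bar>\<epsilon>\<bar> < \<delta>\<^sub>2 \<Longrightarrow> \<exists>!u. angle_solution \<epsilon> (R * \<bar>\<epsilon>\<bar>) (fst u) (snd u)"
      using R0(2)[OF R(1)] by blast
    \<comment> \<open>The last two entries keep \<open>R0 * \<bar>\<epsilon>\<bar>\<close> and
      \<open>C * \<bar>\<epsilon>\<bar>\<close> below \<open>r\<close>, where the passages between
      time and angle are valid.\<close>
    define \<delta> where "\<delta> = min (min \<delta>\<^sub>1 \<delta>\<^sub>2) (min (r / R0) (r / C))"
    show "\<exists>\<delta>>0. \<forall>\<epsilon>. \<epsilon> \<noteq> 0 \<and> \<bar>\<epsilon>\<bar> < \<delta> \<longrightarrow> (\<exists>!u. perturbed \<epsilon> (C * \<bar>\<epsilon>\<bar>) 1 (fst u) (snd u))"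
    proof (intro exI[of _ \<delta>] conjI allI impI)
      show "0 < \<delta>" using \<delta>\<^sub>1(1) \<delta>\<^sub>2(1) r_pos R0(1) C_pos by (simp add: \<delta>_def)
      fix \<epsilon> :: real assume \<epsilon>: "\<epsilon> \<noteq> 0 \<and> \<bar>\<epsilon>\<bar> < \<delta>"
      then have small: "R0 * \<bar>\<epsilon>\<bar> \<le> r" "C * \<bar>\<epsilon>\<bar> \<le> r" "\<bar>\<epsilon>\<bar> < \<delta>\<^sub>1" "\<bar>\<epsilon>\<bar> < \<delta>\<^sub>2"
        using R0(1) C_pos by (auto simp: \<delta>_def field_simps)
      obtain x y where xy: "angle_solution \<epsilon> (R0 * \<bar>\<epsilon>\<bar>) x y"
        using \<delta>\<^sub>1(2)[of \<epsilon>] \<epsilon> small(3) by auto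
      obtain \<psi> z where \<psi>z: "perturbed \<epsilon> ((4 * c / k + 1) * (R0 * \<bar>\<epsilon>\<bar>)) 1 \<psi> z" "corresponds x y \<psi> z"
        using angle_solution_imp_perturbed[OF xy small(1)] .
      have le: "(4 * c / k + 1) * (R0 * \<bar>\<epsilon>\<bar>) \<le> C * \<bar>\<epsilon>\<bar>"
        using mult_right_mono[OF C, of "\<bar>\<epsilon>\<bar>"] by (simp add: mult.assoc)
      have xyR: "angle_solution \<epsilon> (R * \<bar>\<epsilon>\<bar>) x y"
        using angle_solution_mono[OF xy] R(1) by (simp add: mult_right_mono)
      show "\<exists>!u. perturbed \<epsilon> (C * \<bar>\<epsilon>\<bar>) 1 (fst u) (snd u)"
      proof (rule ex1I[of _ "(\<psi>, z)"])
        show "perturbed \<epsilon> (C * \<bar>\<epsilon>\<bar>) 1 (fst (\<psi>, z)) (snd (\<psi>, z))"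
          using perturbed_mono[OF \<psi>z(1) le] by simp
        fix u assume u: "perturbed \<epsilon> (C * \<bar>\<epsilon>\<bar>) 1 (fst u) (snd u)"
        obtain x' y' where xy': "angle_solution \<epsilon> (C * \<bar>\<epsilon>\<bar> * (1 + 1 / s0)) x' y'"
          "corresponds x' y' (fst u) (snd u)"
          using perturbed_imp_angle_solution[OF u small(2)] .
        have "C * \<bar>\<epsilon>\<bar> * (1 + 1 / s0) \<le> R * \<bar>\<epsilon>\<bar>"
          using mult_right_mono[OF R(2), of "\<bar>\<epsilon>\<bar>"] by (simp add: mult_ac)
        from angle_solution_mono[OF xy'(1) this] have "(x', y') = (x, y)"
          using \<delta>\<^sub>2(2)[of \<epsilon>] \<epsilon> small(4) xyR by (metis fst_conv snd_conv)
        then show "u = (\<psi>, z)"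
          using corresponds_unique[OF xy'(2)] \<psi>z(2) by (auto simp: prod_eq_iff)
      qed
    qed
  qed
qed

text \<open>The product \<epsilon> z, the square of z and the distance to the correspondingly
  reflected leading term are unchanged, while both sides of the equation for z change sign.\<close>

lemma perturbed_reflect: "perturbed \<epsilon> \<rho> (-1) \<psi> z \<longleftrightarrow> perturbed (- \<epsilon>) \<rho> 1 \<psi> (\<lambda>t. - z t)"
proof -
  have "(z has_real_derivative \<epsilon> * \<gamma> t * deriv \<psi> t) (at t) \<longleftrightarrow>
      ((\<lambda>t. - z t) has_real_derivative - \<epsilon> * \<gamma> t * deriv \<psi> t) (at t)" for t
    by (subst DERIV_uminus_iff) simp
  moreover have "dist (\<psi> t, z t) (leading_term k c d \<alpha>\<^sub>0 (-1) t) =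
      dist (\<psi> t, - z t) (leading_term k c d \<alpha>\<^sub>0 1 t)" for t
  proof -
    have "(- z t - z0)\<^sup>2 = (z t + z0)\<^sup>2"
      by (simp add: power2_eq_square algebra_simps)
    then show ?thesis by (simp add: leading_term_eq dist_prod_def dist_real_def)
  qed
  ultimately show ?thesis
    by (simp add: perturbed_def is_solution_def shift_periodic_def on_level_set_def uniformly_within_def)
qed

theorem two_perturbed_solutions:
  "\<exists>C\<^sub>0>0. \<forall>C\<ge>C\<^sub>0. \<exists>\<delta>>0. \<forall>\<epsilon>. \<epsilon> \<noteq> 0 \<and> - \<delta> < \<epsilon> \<and> \<epsilon> < \<delta> \<longrightarrow>
    (\<exists>\<psi>\<^sub>p z\<^sub>p \<psi>\<^sub>m z\<^sub>m. (\<psi>\<^sub>p, z\<^sub>p) \<noteq> (\<psi>\<^sub>m, z\<^sub>m) \<and>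
      {(\<psi>, z). perturbed \<epsilon> (C * \<bar>\<epsilon>\<bar>) 1 \<psi> z} = {(\<psi>\<^sub>p, z\<^sub>p)} \<and>
      {(\<psi>, z). perturbed \<epsilon> (C * \<bar>\<epsilon>\<bar>) (-1) \<psi> z} = {(\<psi>\<^sub>m, z\<^sub>m)})"
proof -
  obtain C\<^sub>0 where C\<^sub>0: "0 < C\<^sub>0" "\<And>C. C\<^sub>0 \<le> C \<Longrightarrow> \<exists>\<delta>>0. \<forall>\<epsilon>. \<epsilon> \<noteq> 0 \<and> \<bar>\<epsilon>\<bar> < \<delta> \<longrightarrow>
      (\<exists>!u. perturbed \<epsilon> (C * \<bar>\<epsilon>\<bar>) 1 (fst u) (snd u))"
    using ex1_perturbed by blast
  show ?thesis
  proof (rule exI[of _ C\<^sub>0], intro conjI allI impI)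
    fix C assume C: "C\<^sub>0 \<le> C"
    from C\<^sub>0(2)[OF this] obtain \<delta> where \<delta>: "0 < \<delta>"
      "\<forall>\<epsilon>. \<epsilon> \<noteq> 0 \<and> \<bar>\<epsilon>\<bar> < \<delta> \<longrightarrow> (\<exists>!u. perturbed \<epsilon> (C * \<bar>\<epsilon>\<bar>) 1 (fst u) (snd u))"
      by (elim exE conjE)
    have "0 < C" using C C\<^sub>0(1) by simp
    show "\<exists>\<delta>>0. \<forall>\<epsilon>. \<epsilon> \<noteq> 0 \<and> - \<delta> < \<epsilon> \<and> \<epsilon> < \<delta> \<longrightarrow>
      (\<exists>\<psi>\<^sub>p z\<^sub>p \<psi>\<^sub>m z\<^sub>m. (\<psi>\<^sub>p, z\<^sub>p) \<noteq> (\<psi>\<^sub>m, z\<^sub>m) \<and>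
        {(\<psi>, z). perturbed \<epsilon> (C * \<bar>\<epsilon>\<bar>) 1 \<psi> z} = {(\<psi>\<^sub>p, z\<^sub>p)} \<and>
        {(\<psi>, z). perturbed \<epsilon> (C * \<bar>\<epsilon>\<bar>) (-1) \<psi> z} = {(\<psi>\<^sub>m, z\<^sub>m)})"
    \<comment> \<open>\<open>z0 / C\<close> keeps the radius below \<open>z0\<close>, so z is
      positive on the first solution and negative on the second; hence the two are distinct.\<close>
    proof (intro exI[of _ "min \<delta> (z0 / C)"] conjI allI impI)
      show "0 < min \<delta> (z0 / C)" using \<delta>(1) z0_pos \<open>0 < C\<close> by simp
      fix \<epsilon> assume \<epsilon>: "\<epsilon> \<noteq> 0 \<and> - min \<delta> (z0 / C) < \<epsilon> \<and> \<epsilon> < min \<delta> (z0 / C)"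
      then have "\<bar>\<epsilon>\<bar> < min \<delta> (z0 / C)" by linarith
      then have small: "\<bar>\<epsilon>\<bar> < \<delta>" "C * \<bar>\<epsilon>\<bar> < z0"
        using \<open>0 < C\<close> by (auto simp: field_simps)
      have *: "\<exists>!u. perturbed \<epsilon>' (C * \<bar>\<epsilon>'\<bar>) 1 (fst u) (snd u)" if "\<bar>\<epsilon>'\<bar> = \<bar>\<epsilon>\<bar>" for \<epsilon>'
        using \<delta>(2)[rule_format, of \<epsilon>'] \<epsilon> small(1) that by (metis abs_eq_0_iff)
      obtain \<psi>\<^sub>p z\<^sub>p where plus: "perturbed \<epsilon> (C * \<bar>\<epsilon>\<bar>) 1 \<psi>\<^sub>p z\<^sub>p"
        and plus_unique: "\<And>\<psi> z. perturbed \<epsilon> (C * \<bar>\<epsilon>\<bar>) 1 \<psi> z \<Longrightarrow> \<psi> = \<psi>\<^sub>p \<and> z = z\<^sub>p"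
        using *[OF refl] by (metis fst_conv snd_conv)
      obtain \<psi>\<^sub>m z\<^sub>m where minus: "perturbed (- \<epsilon>) (C * \<bar>\<epsilon>\<bar>) 1 \<psi>\<^sub>m z\<^sub>m"
        and minus_unique: "\<And>\<psi> z. perturbed (- \<epsilon>) (C * \<bar>\<epsilon>\<bar>) 1 \<psi> z \<Longrightarrow> \<psi> = \<psi>\<^sub>m \<and> z = z\<^sub>m"
        using *[OF abs_minus_cancel] unfolding abs_minus_cancel by (metis fst_conv snd_conv)
      have m: "perturbed \<epsilon> (C * \<bar>\<epsilon>\<bar>) (-1) \<psi>\<^sub>m (\<lambda>t. - z\<^sub>m t)"
        unfolding perturbed_reflect using minus by simp
      have m_unique: "\<psi> = \<psi>\<^sub>m \<and> z = (\<lambda>t. - z\<^sub>m t)" if "perturbed \<epsilon> (C * \<bar>\<epsilon>\<bar>) (-1) \<psi> z" for \<psi> z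
        using minus_unique[OF that[unfolded perturbed_reflect]] by auto
      have "\<bar>z\<^sub>p 0 - z0\<bar> < z0" "\<bar>- z\<^sub>m 0 + z0\<bar> < z0"
        using within_bounds(2)[of "C * \<bar>\<epsilon>\<bar>" 1 \<psi>\<^sub>p z\<^sub>p 0]
          within_bounds(2)[of "C * \<bar>\<epsilon>\<bar>" "-1" \<psi>\<^sub>m "\<lambda>t. - z\<^sub>m t" 0] plus m small(2)
        by (auto simp: perturbed_def)
      then have "z\<^sub>p 0 \<noteq> - z\<^sub>m 0" by linarith
      then have "(\<psi>\<^sub>p, z\<^sub>p) \<noteq> (\<psi>\<^sub>m, \<lambda>t. - z\<^sub>m t)" by auto
      moreover have "{(\<psi>, z). perturbed \<epsilon> (C * \<bar>\<epsilon>\<bar>) 1 \<psi> z} = {(\<psi>\<^sub>p, z\<^sub>p)}"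
        using plus plus_unique by blast
      moreover have "{(\<psi>, z). perturbed \<epsilon> (C * \<bar>\<epsilon>\<bar>) (-1) \<psi> z} = {(\<psi>\<^sub>m, \<lambda>t. - z\<^sub>m t)}"
        using m m_unique by blast
      ultimately show "\<exists>\<psi>\<^sub>p z\<^sub>p \<psi>\<^sub>m z\<^sub>m. (\<psi>\<^sub>p, z\<^sub>p) \<noteq> (\<psi>\<^sub>m, z\<^sub>m) \<and>
        {(\<psi>, z). perturbed \<epsilon> (C * \<bar>\<epsilon>\<bar>) 1 \<psi> z} = {(\<psi>\<^sub>p, z\<^sub>p)} \<and>
        {(\<psi>, z). perturbed \<epsilon> (C * \<bar>\<epsilon>\<bar>) (-1) \<psi> z} = {(\<psi>\<^sub>m, z\<^sub>m)}"
        by blast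
    qed
  qed (rule C\<^sub>0(1))
qed

end

theorem theorem10:
  fixes c k d \<alpha>\<^sub>0 :: real and \<gamma> :: "real \<Rightarrow> real" and p q :: nat
  assumes "c > 0" and "0 < k" and "k < 1"
    and "\<And>t. \<gamma> (t + 1) = \<gamma> t" and "C2_real \<gamma>"
    and "p > 0" and "q > 0"
    and "complete_ellK k * k = c * real p / real q"
    and "d < 8 * c\<^sup>2 / k\<^sup>2 * (1 - k\<^sup>2)"
    and "integral {0..real p} (\<lambda>t. \<gamma> (t + \<alpha>\<^sub>0) * jacobi_dn (2 * c * t / k) k) = 0"
    and "integral {0..real p} (\<lambda>t. deriv \<gamma> (t + \<alpha>\<^sub>0) * jacobi_dn (2 * c * t / k) k) \<noteq> 0"
  shows "\<exists>C\<^sub>0>0. \<forall>C\<ge>C\<^sub>0. \<exists>\<delta>>0. \<forall>\<epsilon>. \<epsilon> \<noteq> 0 \<and> - \<delta> < \<epsilon> \<and> \<epsilon> < \<delta> \<longrightarrow>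
    (\<exists>\<psi>\<^sub>p z\<^sub>p \<psi>\<^sub>m z\<^sub>m. (\<psi>\<^sub>p, z\<^sub>p) \<noteq> (\<psi>\<^sub>m, z\<^sub>m) \<and>
      {(\<psi>, z). is_solution c \<gamma> \<epsilon> \<psi> z \<and> shift_periodic p q \<psi> z \<and> on_level_set c d \<psi> z \<and>
         uniformly_within (C * \<bar>\<epsilon>\<bar>) (leading_term k c d \<alpha>\<^sub>0 1) \<psi> z} = {(\<psi>\<^sub>p, z\<^sub>p)} \<and>
      {(\<psi>, z). is_solution c \<gamma> \<epsilon> \<psi> z \<and> shift_periodic p q \<psi> z \<and> on_level_set c d \<psi> z \<and>
         uniformly_within (C * \<bar>\<epsilon>\<bar>) (leading_term k c d \<alpha>\<^sub>0 (-1)) \<psi> z} = {(\<psi>\<^sub>m, z\<^sub>m)})"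
proof -
  interpret forced_pendulum k c d \<alpha>\<^sub>0 \<gamma> p q
    using assms by unfold_locales (simp_all add: periodic_def)
  show ?thesis
    using two_perturbed_solutions unfolding perturbed_def .
qed

end
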